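(* Let the classes of distributions $\mathcal{J}$, $\mathcal{K}$, $\mathcal{K}^c$, $\mathcal{S}(\beta)$ ($\beta\ge 0$), $\mathcal{J}(\mathcal{K})_i$, $\mathcal{J}(\mathcal{K}^c)_i$, $\mathcal{J}_i$ ($i=1,2$) be as defined in the context. Then: (i) $\mathcal{J}\cap\mathcal{K}^c=\mathcal{J}(\mathcal{K}^c)_1\cup\mathcal{J}(\mathcal{K}^c)_2$, and $\mathcal{J}(\mathcal{K}^c)_i\setminus\big(\bigcup_{\beta>0}\mathcal{S}(\beta)\big)\neq\emptyset$ for $i=1,2$. (ii) $\mathcal{J}=\mathcal{J}_1\cup\mathcal{J}_2$, and $\mathcal{J}_i\setminus\big(\bigcup_{\beta\ge 0}\mathcal{S}(\beta)\big)\neq\emptyset$ for $i=1,2$.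
   Context: All distributions are probability distributions $F$ with unbounded support contained in $[0,\infty)$; $\overline F:=1-F$ is the tail and $F^{*2}=F*F$ the two-fold convolution. All asymptotic relations are as $x\to\infty$. For positive functions $g,h$ on $[0,\infty)$: $g\sim h$ means $g(x)/h(x)\to1$; $g=O(h)$ means $\limsup g(x)/h(x)<\infty$; $g\approx h$ means $g=O(h)$ and $h=O(g)$. $F$ is weakly tail equivalent to $F_1$ if $\overline F\approx\overline{F_1}$. Class $\mathcal{J}$: $F\in\mathcal{J}$ iff, for i.i.d. $X_1,X_2,\dots$ with distribution $F$, $S_n=\sum_{i=1}^n X_i$ and $X_{n,1}=\max_{1\le i\le n}X_i$, one has for all $n\ge2$ (equivalently, for $n=2$) $\lim_{K\to\infty}\liminf_{x\to\infty}\mathbb{P}(X_{n,1}>x-K\mid S_n>x)=1$. Class $\mathcal{K}$ (heavy-tailed): $\int_0^\infty e^{\lambda y}F(dy)=\infty$ for all $\lambda>0$. $\mathcal{K}^c$ (light-tailed) is its complement. Class $\mathcal{S}=\mathcal{S}(0)$ (subexponential): $\overline{F^{*2}}(x)\sim 2\overline F(x)$. For $\gamma>0$, $F\in\mathcal{L}(\gamma)$ iff $\overline F(x+t)\sim e^{-\gamma t}\overline F(x)$ for all $t\ne0$; and $F\in\mathcal{S}(\gamma)$ iff $F\in\mathcal{L}(\gamma)$, $\int_0^\infty e^{\gamma y}F(dy)<\infty$ and $\overline{F^{*2}}(x)\sim 2\int_0^\infty e^{\gamma y}F(dy)\,\overline F(x)$. Subclasses: $\mathcal{J}(\mathcal{K}^c)_1:=\{F\in\mathcal{J}\cap\mathcal{K}^c:\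 \text{there exist } \gamma>0 \text{ and } F_1\in\mathcal{S}(\gamma)\text{ with }\overline F\approx\overline{F_1}\}$, $\mathcal{J}(\mathcal{K}^c)_2:=(\mathcal{J}\cap\mathcal{K}^c)\setminus\mathcal{J}(\mathcal{K}^c)_1$; $\mathcal{J}(\mathcal{K})_1:=\{F\in\mathcal{J}\cap\mathcal{K}:\ \text{there exists } F_1\in\mathcal{S}\text{ with }\overline F\approx\overline{F_1}\}$, $\mathcal{J}(\mathcal{K})_2:=(\mathcal{J}\cap\mathcal{K})\setminus\mathcal{J}(\mathcal{K})_1$; $\mathcal{J}_1:=\mathcal{J}(\mathcal{K})_1\cup\mathcal{J}(\mathcal{K}^c)_1$ and $\mathcal{J}_2:=\mathcal{J}(\mathcal{K})_2\cup\mathcal{J}(\mathcal{K}^c)_2$. *)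

theory Defs
  imports "HOL-Probability.Probability"
begin

text \<open>
  A distribution \<open>F\<close> is represented by its law, a probability measure on the Borel sets of the
  reals; its distribution function is \<^term>\<open>cdf F\<close>.
\<close>

definition nonneg_unbounded_distributions :: "real measure set" where
  "nonneg_unbounded_distributions =
     {F. real_distribution F \<and> measure F {..<0} = 0 \<and> (\<forall>x. cdf F x < 1)}"

definition tail :: "real measure \<Rightarrow> real \<Rightarrow> real" where
  "tail F x = 1 - cdf F x"

definition weakly_tail_equivalent :: "real measure \<Rightarrow> real measure \<Rightarrow> bool" where
  "weakly_tail_equivalent F F1 \<longleftrightarrow> tail F \<in> O(tail F1) \<and> tail F1 \<in> O(tail F)"

definition exp_moment :: "real measure \<Rightarrow> real \<Rightarrow> ennreal" where
  "exp_moment F r = (\<integral>\<^sup>+y\<in>{0..}. ennreal (exp (r * y)) \<partial>F)"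

text \<open>
  The conditional probability \<open>P(X\<^bsub>n,1\<^esub> > a | S\<^sub>n > x)\<close>. The i.i.d. variables are the coordinates of
  the \<open>n\<close>-fold product of \<open>F\<close>, indexed from \<open>0\<close>; lemma \<open>iid_max_given_sum_prob\<close> below shows that any
  other i.i.d. family with law \<open>F\<close> gives the same value.
\<close>

definition max_given_sum_prob :: "real measure \<Rightarrow> nat \<Rightarrow> real \<Rightarrow> real \<Rightarrow> real" where
  "max_given_sum_prob F n a x =
     \<P>(\<omega> in (\<Pi>\<^sub>M i\<in>{..<n}. F). Max (\<omega> ` {..<n}) > a \<bar> (\<Sum>i<n. \<omega> i) > x)"

lemma (in prob_space) iid_max_given_sum_prob:
  fixes X :: "nat \<Rightarrow> 'a \<Rightarrow> real"
  assumes n: "n > 0"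
    and indep: "indep_vars (\<lambda>_. borel) X {..<n}"
    and law: "\<And>i. i < n \<Longrightarrow> distr M borel (X i) = F"
  shows "\<P>(\<omega> in M. Max ((\<lambda>i. X i \<omega>) ` {..<n}) > a \<bar> (\<Sum>i<n. X i \<omega>) > x)
           = max_given_sum_prob F n a x"
proof -
  let ?N = "\<Pi>\<^sub>M i\<in>{..<n}. (borel :: real measure)"
  let ?T = "\<lambda>\<omega>. \<lambda>i\<in>{..<n}. X i \<omega>"
  have X: "X i \<in> borel_measurable M" if "i \<in> {..<n}" for i
    using indep that by (auto simp: indep_vars_def)
  have T: "?T \<in> measurable M ?N"
    using X by (intro measurable_restrict) auto
  have "distr M ?N ?T = (\<Pi>\<^sub>M i\<in>{..<n}. distr M borel (X i))"
    using n X indep by (intro indep_vars_iff_distr_eq_PiM'[THEN iffD1]) auto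
  also have "\<dots> = (\<Pi>\<^sub>M i\<in>{..<n}. F)"
    by (intro PiM_cong) (auto simp: law)
  finally have D: "(\<Pi>\<^sub>M i\<in>{..<n}. F) = distr M ?N ?T" ..
  have img: "?T \<omega> ` {..<n} = (\<lambda>i. X i \<omega>) ` {..<n}" for \<omega>
    by auto
  have mx [measurable]: "(\<lambda>\<omega>. Max (\<omega> ` {..<n})) \<in> borel_measurable ?N"
    by (intro borel_measurable_Max) auto
  have P: "\<P>(\<omega> in M. Q (?T \<omega>)) = \<P>(\<omega> in (\<Pi>\<^sub>M i\<in>{..<n}. F). Q \<omega>)"
    if [measurable]: "Measurable.pred ?N Q" for Q
  proof -
    have "\<P>(\<omega> in (\<Pi>\<^sub>M i\<in>{..<n}. F). Q \<omega>) = measure M (?T -` {\<omega> \<in> space ?N. Q \<omega>} \<inter> space M)"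
      unfolding D by (subst measure_distr[OF T]) (auto simp: space_PiM)
    also have "?T -` {\<omega> \<in> space ?N. Q \<omega>} \<inter> space M = {\<omega> \<in> space M. Q (?T \<omega>)}"
      using measurable_space[OF T] by auto
    finally show ?thesis ..
  qed
  have "\<P>(\<omega> in M. Max (?T \<omega> ` {..<n}) > a \<bar> (\<Sum>i<n. ?T \<omega> i) > x) = max_given_sum_prob F n a x"
    unfolding max_given_sum_prob_def cond_prob_def
    by (subst (1 2) P[symmetric]) auto
  then show ?thesis
    by (simp add: img)
qed

definition class_J :: "real measure set" where
  "class_J = {F \<in> nonneg_unbounded_distributions. \<forall>n\<ge>2.
     ((\<lambda>K. Liminf at_top (\<lambda>x. ereal (max_given_sum_prob F n (x - K) x))) \<longlongrightarrow> 1) at_top}"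

definition class_K :: "real measure set" where
  "class_K = {F \<in> nonneg_unbounded_distributions. \<forall>r>0. exp_moment F r = \<infinity>}"

definition class_Kc :: "real measure set" where
  "class_Kc = nonneg_unbounded_distributions - class_K"

definition subexponential :: "real measure set" where
  "subexponential = {F \<in> nonneg_unbounded_distributions.
     tail (convolution F F) \<sim>[at_top] (\<lambda>x. 2 * tail F x)}"

definition class_L :: "real \<Rightarrow> real measure set" where
  "class_L \<gamma> = {F \<in> nonneg_unbounded_distributions. \<forall>t. t \<noteq> 0 \<longrightarrow>
     (\<lambda>x. tail F (x + t)) \<sim>[at_top] (\<lambda>x. exp (- \<gamma> * t) * tail F x)}"

text \<open>Only \<open>\<beta> \<ge> 0\<close> is meaningful.\<close>

definition class_S :: "real \<Rightarrow> real measure set" where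
  "class_S \<beta> = (if \<beta> = 0 then subexponential else
     {F \<in> class_L \<beta>. exp_moment F \<beta> < \<infinity> \<and>
        tail (convolution F F) \<sim>[at_top] (\<lambda>x. 2 * enn2real (exp_moment F \<beta>) * tail F x)})"

definition class_JKc1 :: "real measure set" where
  "class_JKc1 = {F \<in> class_J \<inter> class_Kc. \<exists>\<gamma>>0. \<exists>F1\<in>class_S \<gamma>. weakly_tail_equivalent F F1}"

definition class_JKc2 :: "real measure set" where
  "class_JKc2 = (class_J \<inter> class_Kc) - class_JKc1"

definition class_JK1 :: "real measure set" where
  "class_JK1 = {F \<in> class_J \<inter> class_K. \<exists>F1\<in>class_S 0. weakly_tail_equivalent F F1}"

definition class_JK2 :: "real measure set" where
  "class_JK2 = (class_J \<inter> class_K) - class_JK1"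

definition class_J1 :: "real measure set" where
  "class_J1 = class_JK1 \<union> class_JKc1"

definition class_J2 :: "real measure set" where
  "class_J2 = class_JK2 \<union> class_JKc2"

end

theory Submission
  imports Defs "HOL-Real_Asymp.Real_Asymp"
begin

text \<open>
  Both witnesses are laws on the natural numbers with
  \<open>P (X \<ge> m) = T m = exp (D m - m) / (1 + m)^4\<close>, where the delay \<open>D\<close> is nondecreasing, grows by at most
  \<open>1\<close> per step and satisfies \<open>exp (D m) \<le> (1 + m)^2\<close>. Monotonicity of \<open>D\<close> gives
  \<open>T i * T (m - i) \<le> 16 * T m * (1 + i)^-2\<close> for \<open>2 * i \<le> m\<close>, so the part of the convolution in which
  both summands are at least \<open>k\<close> is \<open>O (T m / k)\<close>; this is a single big jump and yields membership in
  \<open>J\<close>. A lattice law is not in \<open>L(\<gamma>)\<close> for \<open>\<gamma> > 0\<close>, because its tail is constant on unit intervals, and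
  a subexponential law is long-tailed, hence not light-tailed.

  With \<open>D = 0\<close> the tail is weakly equivalent to \<open>exp (- x) / (1 + x)^4\<close>, the tail of a law in \<open>S(1)\<close>.
  With a delay that has arbitrarily long runs of unit steps, the tail has arbitrarily long stretches
  on which it barely decays, and no tail in \<open>L(\<gamma>)\<close> with \<open>\<gamma> > 0\<close> is weakly equivalent to it.
\<close>

subsection \<open>Subexponential laws are heavy-tailed\<close>

lemma tail_eq_measure:
  assumes "real_distribution F"
  shows "tail F x = measure F {x<..}"
proof -
  interpret real_distribution F by fact
  have "measure F {x<..} = measure F (space F - {..x})"
    by (rule arg_cong[where f = "measure F"]) auto
  also have "\<dots> = 1 - cdf F x"
    by (subst prob_compl) (auto simp: cdf_def)
  finally show ?thesis by (simp add: tail_def)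
qed

lemma tail_antimono:
  assumes "real_distribution F" "x \<le> y"
  shows "tail F y \<le> tail F x"
proof -
  interpret real_distribution F by fact
  show ?thesis using cdf_nondecreasing[OF assms(2)] by (simp add: tail_def)
qed

lemma real_distribution_convolution:
  assumes "real_distribution F"
  shows "real_distribution (convolution F F)"
proof -
  interpret real_distribution F by fact
  interpret P: pair_prob_space F F ..
  have "prob_space (convolution F F)"
    unfolding convolution_def by (rule P.prob_space_distr) simp
  then show ?thesis
    unfolding real_distribution_def real_distribution_axioms_def by simp
qed

lemma tail_convolution_eq_measure:
  assumes "real_distribution F"
  shows "tail (convolution F F) x = measure (F \<Otimes>\<^sub>M F) {(a, b). x < a + b}"
proof -
  interpret real_distribution F by fact
  interpret P: pair_prob_space F F ..
  have "tail (convolution F F) x = measure (convolution F F) {x<..}"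
    using real_distribution_convolution[OF assms] by (rule tail_eq_measure)
  also have "\<dots> = measure (F \<Otimes>\<^sub>M F) {(a, b). x < a + b}"
    unfolding convolution_def
    by (subst measure_distr) (auto intro!: arg_cong[where f = "measure _"] simp: space_pair_measure)
  finally show ?thesis .
qed

lemma tail_nonneg_unbounded_pos:
  assumes "F \<in> nonneg_unbounded_distributions"
  shows "tail F x > 0"
  using assms by (auto simp: nonneg_unbounded_distributions_def tail_def)

lemma tail_tendsto_0:
  assumes "real_distribution F"
  shows "(tail F \<longlongrightarrow> 0) at_top"
proof -
  interpret real_distribution F by fact
  have "((\<lambda>x. 1 - cdf F x) \<longlongrightarrow> 1 - 1) at_top"
    by (intro tendsto_intros cdf_lim_at_top_prob)
  then show ?thesis by (simp add: tail_def[abs_def])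
qed

text \<open>Three disjoint parts of the event that the sum exceeds \<open>x\<close>: the first
  summand lies in \<open>{0..t}\<close> and the second exceeds \<open>x\<close>; the first lies in
  \<open>{t<..x}\<close> and the second exceeds \<open>x - t\<close>; the first exceeds
  \<open>x\<close>. The middle part brings in \<open>tail F (x - t)\<close>.\<close>

lemma tail_convolution_lower:
  assumes F: "F \<in> nonneg_unbounded_distributions" and t: "0 \<le> t" "t \<le> x"
  shows "tail F x * (2 - tail F t) + (tail F t - tail F x) * tail F (x - t) \<le> tail (convolution F F) x"
proof -
  have rd: "real_distribution F" and neg: "measure F {..<0} = 0"
    using F by (auto simp: nonneg_unbounded_distributions_def)
  interpret real_distribution F by fact
  interpret P: pair_prob_space F F ..
  have meas [measurable]: "{(a::real, b::real). x < a + b} \<in> sets (F \<Otimes>\<^sub>M F)"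
  proof -
    have "{p \<in> space (F \<Otimes>\<^sub>M F). x < fst p + snd p} \<in> sets (F \<Otimes>\<^sub>M F)" by measurable
    also have "{p \<in> space (F \<Otimes>\<^sub>M F). x < fst p + snd p} = {(a, b). x < a + b}"
      by (auto simp: space_pair_measure)
    finally show ?thesis .
  qed
  have m0: "measure F {0..} = 1"
  proof -
    have "measure F {0..} = measure F (space F - {..<0})"
      by (rule arg_cong[where f = "measure F"]) auto
    also have "\<dots> = 1" by (subst prob_compl) (auto simp: neg)
    finally show ?thesis .
  qed
  have m1: "measure F {0..t} = 1 - tail F t"
  proof -
    have "measure F ({0..t} \<union> {t<..}) = measure F {0..t} + measure F {t<..}"
      by (rule finite_measure_Union) auto
    moreover have "{0..t} \<union> {t<..} = {0..}" using t by auto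
    ultimately show ?thesis using m0 by (simp add: tail_eq_measure[OF rd])
  qed
  have m2: "measure F {t<..x} = tail F t - tail F x"
  proof -
    have "measure F ({t<..x} \<union> {x<..}) = measure F {t<..x} + measure F {x<..}"
      by (rule finite_measure_Union) auto
    moreover have "{t<..x} \<union> {x<..} = {t<..}" using t by auto
    ultimately show ?thesis by (simp add: tail_eq_measure[OF rd])
  qed
  let ?A = "{0..t} \<times> {x<..}" and ?B = "{t<..x} \<times> {x-t<..}" and ?C = "{x<..} \<times> {0::real..}"
  have times: "measure (F \<Otimes>\<^sub>M F) (X \<times> Y) = measure F X * measure F Y"
    if "X \<in> sets borel" "Y \<in> sets borel" for X Y
    using that by (simp add: measure_def emeasure_pair_measure_Times enn2real_mult)
  have "measure (F \<Otimes>\<^sub>M F) (?A \<union> ?B \<union> ?C) = measure (F \<Otimes>\<^sub>M F) (?A \<union> ?B) + measure (F \<Otimes>\<^sub>M F) ?C"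
    using t by (intro P.finite_measure_Union) auto
  also have "measure (F \<Otimes>\<^sub>M F) (?A \<union> ?B) = measure (F \<Otimes>\<^sub>M F) ?A + measure (F \<Otimes>\<^sub>M F) ?B"
    using t by (intro P.finite_measure_Union) auto
  finally have "measure (F \<Otimes>\<^sub>M F) (?A \<union> ?B \<union> ?C) =
      (1 - tail F t) * tail F x + (tail F t - tail F x) * tail F (x - t) + tail F x"
    by (simp add: times m0 m1 m2 tail_eq_measure[OF rd, symmetric])
  moreover have "measure (F \<Otimes>\<^sub>M F) (?A \<union> ?B \<union> ?C) \<le> measure (F \<Otimes>\<^sub>M F) {(a, b). x < a + b}"
    using t meas by (intro P.finite_measure_mono) auto
  ultimately show ?thesis
    by (simp add: tail_convolution_eq_measure[OF rd] algebra_simps)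
qed

text \<open>Dividing the lower bound for the convolution tail with \<open>t = 1\<close> by
  \<open>tail F x\<close> and solving for the ratio bounds it from above. By subexponentiality the
  upper bound tends to \<open>tail F 1 / tail F 1\<close>; monotonicity of the tail gives the lower
  bound 1.\<close>

lemma subexponential_imp_long_tailed:
  assumes "F \<in> subexponential"
  shows "((\<lambda>x. tail F (x - 1) / tail F x) \<longlongrightarrow> 1) at_top"
proof -
  have F: "F \<in> nonneg_unbounded_distributions"
    and eq: "tail (convolution F F) \<sim>[at_top] (\<lambda>x. 2 * tail F x)"
    using assms by (auto simp: subexponential_def)
  have rd: "real_distribution F" using F by (auto simp: nonneg_unbounded_distributions_def)
  note pos = tail_nonneg_unbounded_pos[OF F]
  have "((\<lambda>x. tail (convolution F F) x / (2 * tail F x)) \<longlongrightarrow> 1) at_top"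
    using eq by (rule asymp_equivD_strong) (use pos in \<open>auto simp: less_imp_neq[symmetric] intro!: always_eventually\<close>)
  from tendsto_mult[OF tendsto_const[of 2] this]
  have lim: "((\<lambda>x. tail (convolution F F) x / tail F x) \<longlongrightarrow> 2) at_top"
    by simp
  have ub: "((\<lambda>x. (tail (convolution F F) x / tail F x - (2 - tail F 1)) / (tail F 1 - tail F x))
      \<longlongrightarrow> (2 - (2 - tail F 1)) / (tail F 1 - 0)) at_top"
    using pos[of 1] by (intro tendsto_intros lim tail_tendsto_0 rd) auto
  have lt: "eventually (\<lambda>x. tail F x < tail F 1) at_top"
    using tail_tendsto_0[OF rd] pos[of 1] by (rule order_tendstoD)
  show ?thesis
  proof (rule tendsto_sandwich[OF _ _ tendsto_const])
    show "\<forall>\<^sub>F x in at_top. 1 \<le> tail F (x - 1) / tail F x"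
      using pos tail_antimono[OF rd] by (intro always_eventually) (auto simp: le_divide_eq)
    show "\<forall>\<^sub>F x in at_top. tail F (x - 1) / tail F x
        \<le> (tail (convolution F F) x / tail F x - (2 - tail F 1)) / (tail F 1 - tail F x)"
      using lt eventually_ge_at_top[of 1]
    proof eventually_elim
      case (elim x)
      have "(tail F x * (2 - tail F 1) + (tail F 1 - tail F x) * tail F (x - 1)) / tail F x
          \<le> tail (convolution F F) x / tail F x"
        using tail_convolution_lower[OF F, of 1 x] pos[of x] elim by (intro divide_right_mono) auto
      also have "(tail F x * (2 - tail F 1) + (tail F 1 - tail F x) * tail F (x - 1)) / tail F x
          = (2 - tail F 1) + tail F (x - 1) / tail F x * (tail F 1 - tail F x)"
        using pos[of x] by (simp add: add_divide_distrib)
      finally show ?case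
        using elim by (simp add: pos_le_divide_eq)
    qed
    show "((\<lambda>x. (tail (convolution F F) x / tail F x - (2 - tail F 1)) / (tail F 1 - tail F x))
      \<longlongrightarrow> 1) at_top"
      using ub pos[of 1] by simp
  qed
qed

text \<open>Markov's inequality for the exponential of \<open>r\<close> times the variable.\<close>

lemma tail_exp_bound:
  assumes "real_distribution F" and "exp_moment F r < \<infinity>" "x \<ge> 0" "r \<ge> 0"
  shows "tail F x \<le> enn2real (exp_moment F r) * exp (- r * x)"
proof -
  interpret real_distribution F by fact
  have "(\<integral>\<^sup>+y. ennreal (exp (r * x)) * indicator {x<..} y \<partial>F) \<le> exp_moment F r"
    unfolding exp_moment_def
    using assms by (intro nn_integral_mono) (auto simp: indicator_def mult_left_mono)
  then have "ennreal (exp (r * x)) * emeasure F {x<..} \<le> exp_moment F r"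
    by (subst (asm) nn_integral_cmult_indicator) auto
  then have "ennreal (exp (r * x) * tail F x) \<le> ennreal (enn2real (exp_moment F r))"
    using assms by (simp add: tail_eq_measure emeasure_eq_measure ennreal_mult less_top)
  then have "exp (r * x) * tail F x \<le> enn2real (exp_moment F r)"
    by (simp add: ennreal_le_iff)
  then show ?thesis
    by (simp add: exp_minus field_simps)
qed

text \<open>Long-tailedness eventually limits the loss per unit step to a factor
  \<open>exp (r / 2)\<close>, whereas a finite moment of order \<open>r\<close> forces decay like
  \<open>exp (- r * x)\<close>. Along \<open>a + n\<close> the two rates contradict each
  other.\<close>

lemma subexponential_not_light_tailed:
  assumes "F \<in> subexponential"
  shows "F \<notin> class_Kc"
proof
  assume "F \<in> class_Kc"
  then obtain r where r: "r > 0" and fin: "exp_moment F r < \<infinity>"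
    and F: "F \<in> nonneg_unbounded_distributions"
    by (auto simp: class_Kc_def class_K_def less_top)
  have rd: "real_distribution F" using F by (auto simp: nonneg_unbounded_distributions_def)
  note pos = tail_nonneg_unbounded_pos[OF F]
  have "eventually (\<lambda>x. tail F (x - 1) / tail F x < exp (r / 2)) at_top"
    using subexponential_imp_long_tailed[OF assms] r by (intro order_tendstoD(2)) auto
  then obtain N where N: "tail F (x - 1) / tail F x < exp (r / 2)" if "x \<ge> N" for x
    by (auto simp: eventually_at_top_linorder)
  \<comment> \<open>The maximum with 0 is there because the Markov bound is stated for nonnegative
    arguments.\<close>
  define a where "a = max N 0"
  have geo: "tail F a \<le> exp (r / 2 * real n) * tail F (a + real n)" for n
  proof (induction n)
    case (Suc n)
    have "tail F (a + real n) \<le> exp (r / 2) * tail F (a + real (Suc n))"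
    proof -
      have "tail F (a + real (Suc n) - 1) / tail F (a + real (Suc n)) < exp (r / 2)"
        by (rule N) (simp add: a_def)
      moreover have "a + real (Suc n) - 1 = a + real n" by simp
      ultimately show ?thesis
        using pos[of "a + real (Suc n)"] by (simp add: pos_divide_less_eq)
    qed
    then have "exp (r / 2 * real n) * tail F (a + real n)
        \<le> exp (r / 2 * real n) * (exp (r / 2) * tail F (a + real (Suc n)))"
      by (intro mult_left_mono) auto
    also have "\<dots> = exp (r / 2 * real (Suc n)) * tail F (a + real (Suc n))"
      by (simp add: mult.assoc[symmetric] exp_add[symmetric] ring_distribs add_divide_distrib add.commute)
    finally show ?case using Suc by linarith
  qed simp
  define C where "C = enn2real (exp_moment F r) * exp (- r * a)"
  have bd: "tail F a \<le> C * exp (- (r / 2) * real n)" for n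
  proof -
    have "tail F (a + real n) \<le> enn2real (exp_moment F r) * exp (- r * (a + real n))"
      using tail_exp_bound[OF rd fin] r by (simp add: a_def)
    also have "\<dots> = C * exp (- r * real n)"
      by (simp add: C_def exp_add[symmetric] algebra_simps)
    finally have "exp (r / 2 * real n) * tail F (a + real n) \<le> exp (r / 2 * real n) * (C * exp (- r * real n))"
      by (intro mult_left_mono) auto
    also have "\<dots> = C * exp (- (r / 2) * real n)"
      by (simp add: exp_add[symmetric])
    finally show ?thesis using geo[of n] by linarith
  qed
  have "(\<lambda>n. C * exp (- (r / 2) * real n)) \<longlonglongrightarrow> 0"
    using r by real_asymp
  then have "tail F a \<le> 0"
    by (rule tendsto_lowerbound) (use bd in \<open>auto intro: always_eventually\<close>)
  with pos[of a] show False by simp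
qed


subsection \<open>Laws on the natural numbers and the class of a single big jump\<close>

definition lattice_law :: "nat pmf \<Rightarrow> real measure" where
  "lattice_law p = distr (measure_pmf p) borel real"

lemma real_distribution_lattice_law: "real_distribution (lattice_law p)"
  unfolding lattice_law_def by (rule prob_space.real_distribution_distr[OF measure_pmf.prob_space_axioms]) simp

lemma measure_lattice_law:
  "A \<in> sets borel \<Longrightarrow> measure (lattice_law p) A = measure_pmf.prob p {n. real n \<in> A}"
  unfolding lattice_law_def by (subst measure_distr) (auto simp: vimage_def)

text \<open>The tail is the probability of strictly exceeding \<open>x\<close>, so the first natural
  number counted is the floor of \<open>x\<close> plus one, also when \<open>x\<close> is an
  integer.\<close>

lemma tail_lattice_law:
  assumes "x \<ge> 0"
  shows "tail (lattice_law p) x = measure_pmf.prob p {nat \<lfloor>x\<rfloor> + 1..}"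
proof -
  have "{n. real n \<in> {x<..}} = {nat \<lfloor>x\<rfloor> + 1..}"
    using assms by (auto simp: Suc_le_eq nat_less_iff floor_less_iff)
  then show ?thesis
    by (simp add: tail_eq_measure real_distribution_lattice_law measure_lattice_law)
qed

lemma lattice_law_nonneg_unbounded:
  assumes "\<And>m. measure_pmf.prob p {m..} > 0"
  shows "lattice_law p \<in> nonneg_unbounded_distributions"
proof -
  have "cdf (lattice_law p) x < 1" for x
  proof -
    have "0 < tail (lattice_law p) (max x 0)"
      using assms by (simp add: tail_lattice_law)
    also have "\<dots> \<le> tail (lattice_law p) x"
      by (intro tail_antimono real_distribution_lattice_law) simp
    finally show ?thesis by (simp add: tail_def)
  qed
  then show ?thesis
    by (simp add: nonneg_unbounded_distributions_def real_distribution_lattice_law measure_lattice_law)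
qed

text \<open>At an integer argument a shift by 1/2 leaves the tail unchanged, while
  \<open>class_L\<close> would demand the limiting factor
  \<open>exp (- \<gamma> / 2)\<close>.\<close>

lemma lattice_law_not_class_L:
  assumes "\<gamma> > 0"
  shows "lattice_law p \<notin> class_L \<gamma>"
proof
  let ?T = "tail (lattice_law p)"
  assume L: "lattice_law p \<in> class_L \<gamma>"
  then have pos: "?T x > 0" for x
    by (auto simp: class_L_def intro: tail_nonneg_unbounded_pos)
  have "(\<lambda>x. ?T (x + t)) \<sim>[at_top] (\<lambda>x. exp (- \<gamma> * t) * ?T x)" if "t \<noteq> 0" for t
    using L that unfolding class_L_def by blast
  from this[of "1/2"]
  have "(\<lambda>x. ?T (x + 1/2)) \<sim>[at_top] (\<lambda>x. exp (- \<gamma> * (1/2)) * ?T x)"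
    by simp
  then have "((\<lambda>x. ?T (x + 1/2) / (exp (- \<gamma> * (1/2)) * ?T x)) \<longlongrightarrow> 1) at_top"
    by (rule asymp_equivD_strong) (use pos in \<open>auto simp: less_imp_neq[symmetric] intro!: always_eventually\<close>)
  from filterlim_compose[OF this filterlim_real_sequentially]
  have "(\<lambda>n. ?T (real n + 1/2) / (exp (- \<gamma> * (1/2)) * ?T (real n))) \<longlonglongrightarrow> 1" .
  moreover have "?T (real n + 1/2) = ?T (real n)" for n
  proof -
    have "\<lfloor>real n + 1/2\<rfloor> = int n" by linarith
    then show ?thesis by (simp add: tail_lattice_law)
  qed
  ultimately have "(\<lambda>n. exp (\<gamma> / 2)) \<longlonglongrightarrow> 1"
    using pos by (simp add: less_imp_neq[symmetric] exp_minus field_simps)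
  then have "exp (\<gamma> / 2) = 1" by (simp add: LIMSEQ_const_iff)
  with assms show False by simp
qed

text \<open>The point masses are the differences \<open>T n - T (Suc n)\<close>; they telescope to
  total mass 1 because \<open>T\<close> starts at 1 and tends to 0.\<close>

lemma exists_pmf_with_tail:
  fixes T :: "nat \<Rightarrow> real"
  assumes "T 0 = 1" and dec: "\<And>m. T (Suc m) \<le> T m" and lim: "T \<longlonglongrightarrow> 0"
  obtains p where "\<And>m. measure_pmf.prob p {m..} = T m"
proof -
  let ?f = "\<lambda>n. T n - T (Suc n)"
  have sums: "?f sums 1" using telescope_sums'[OF lim] assms(1) by simp
  have nn: "0 \<le> ?f n" for n using dec[of n] by simp
  have "(\<integral>\<^sup>+ n. ennreal (?f n) \<partial>count_space UNIV) = (\<Sum>n. ennreal (?f n))"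
    by (rule nn_integral_count_space_nat)
  also have "\<dots> = 1"
    using sums by (subst suminf_ennreal2) (use nn in \<open>auto simp: sums_iff\<close>)
  finally have one: "(\<integral>\<^sup>+ n. ennreal (?f n) \<partial>count_space UNIV) = 1" .
  define p where "p = embed_pmf ?f"
  have pmf: "pmf p n = ?f n" for n
    unfolding p_def using nn one by (rule pmf_embed_pmf)
  have "measure_pmf.prob p {m..} = T m" for m
  proof -
    have "measure_pmf.prob p {m..} = measure_pmf.prob p (space p - {..<m})"
      by (rule arg_cong[where f = "measure _"]) auto
    also have "\<dots> = 1 - measure_pmf.prob p {..<m}"
      by (rule measure_pmf.prob_compl) simp
    also have "measure_pmf.prob p {..<m} = (\<Sum>n<m. ?f n)"
      by (simp add: measure_measure_pmf_finite pmf)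
    also have "\<dots> = 1 - T m" by (simp add: sum_lessThan_telescope' assms(1))
    finally show ?thesis by simp
  qed
  then show thesis by (rule that)
qed

section \<open>Sums of independent copies of a lattice law\<close>

lemma prob_pair_pmf_Times:
  "measure_pmf.prob (pair_pmf p q) (A \<times> B) = measure_pmf.prob p A * measure_pmf.prob q B"
proof -
  have "measure_pmf.prob (pair_pmf p q) (A \<times> B)
      = measure_pmf.prob (pair_pmf p q) ((A \<times> B) \<inter> set_pmf (pair_pmf p q))"
    by (simp only: measure_Int_set_pmf)
  also have "(A \<times> B) \<inter> set_pmf (pair_pmf p q) = (A \<inter> set_pmf p) \<times> (B \<inter> set_pmf q)"
    by auto
  also have "measure_pmf.prob (pair_pmf p q) \<dots>
      = measure_pmf.prob p (A \<inter> set_pmf p) * measure_pmf.prob q (B \<inter> set_pmf q)"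
    by (intro measure_pmf_prob_product countable_Int2 countable_set_pmf)
  finally show ?thesis by (simp only: measure_Int_set_pmf)
qed

text \<open>A union bound over the value \<open>i\<close> of coordinate \<open>j\<close>: the
  remaining coordinates must then contribute at least \<open>m - i\<close>. The point mass at
  \<open>i\<close> is estimated by the tail \<open>T i\<close>, so that only tails enter the later
  convolution sums.\<close>

lemma prob_Pi_pmf_sum_one_coordinate_le:
  fixes p :: "nat pmf" and G T :: "nat \<Rightarrow> real"
  assumes A: "finite A" "j \<notin> A"
    and G: "\<And>m. measure_pmf.prob (Pi_pmf A 0 (\<lambda>_. p)) {\<omega>. m \<le> sum \<omega> A} \<le> G m"
    and T: "\<And>m. measure_pmf.prob p {m..} \<le> T m"
    and I: "finite I"
  shows "measure_pmf.prob (Pi_pmf (insert j A) 0 (\<lambda>_. p)) {\<omega>. \<omega> j \<in> I \<and> m \<le> sum \<omega> (insert j A)}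
          \<le> (\<Sum>i\<in>I. T i * G (m - i))"
proof -
  let ?P = "pair_pmf p (Pi_pmf A 0 (\<lambda>_. p))"
  let ?S = "\<lambda>i. {i} \<times> {\<omega>. m - i \<le> sum \<omega> A}"
  \<comment> \<open>\<open>Pi_pmf_insert\<close> produces the function updated at \<open>j\<close>,
    and \<open>j\<close> is outside \<open>A\<close>.\<close>
  have sum_upd: "(\<Sum>x\<in>A. if x = j then y else \<omega> x) = sum \<omega> A" for \<omega> :: "'a \<Rightarrow> nat" and y
    using A by (intro sum.cong) auto
  have G0: "0 \<le> G m" for m using G[of m] by (rule order_trans[OF measure_nonneg])
  have "measure_pmf.prob (Pi_pmf (insert j A) 0 (\<lambda>_. p)) {\<omega>. \<omega> j \<in> I \<and> m \<le> sum \<omega> (insert j A)}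
      = measure_pmf.prob ?P {(y, \<omega>). y \<in> I \<and> m \<le> y + sum \<omega> A}"
    using A by (subst Pi_pmf_insert) (auto simp: vimage_def case_prod_unfold sum_upd)
  also have "\<dots> \<le> measure_pmf.prob ?P (\<Union>i\<in>I. ?S i)"
    by (rule measure_pmf.finite_measure_mono) auto
  also have "\<dots> \<le> (\<Sum>i\<in>I. measure_pmf.prob ?P (?S i))"
    by (rule measure_UNION_le) (use I in auto)
  also have "\<dots> \<le> (\<Sum>i\<in>I. T i * G (m - i))"
  proof (rule sum_mono)
    fix i
    have "measure_pmf.prob p {i} \<le> T i"
      by (rule order_trans[OF measure_pmf.finite_measure_mono T]) auto
    then show "measure_pmf.prob ?P (?S i) \<le> T i * G (m - i)"
      unfolding prob_pair_pmf_Times by (intro mult_mono' G) auto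
  qed
  finally show ?thesis .
qed

text \<open>The sum in \<open>truncated_convolution_le\<close> runs over the splittings of
  \<open>m\<close> with both parts at least \<open>k\<close>. The bound is uniform in
  \<open>m\<close> and vanishes relative to \<open>T m\<close> as \<open>k\<close> grows, which is
  the analytic form of a single big jump; at \<open>k = 0\<close> it bounds the full convolution by
  \<open>c * T m\<close>.\<close>

locale lattice_tail =
  fixes p :: "nat pmf" and T :: "nat \<Rightarrow> real" and c :: real
  assumes prob_atLeast: "\<And>m. measure_pmf.prob p {m..} = T m"
    and T_pos: "\<And>m. T m > 0"
    and truncated_convolution_le: "\<And>k m. (\<Sum>i\<in>{k..m-k}. T i * T (m - i)) \<le> c / (1 + real k) * T m"
begin

lemma T_0: "T 0 = 1"
  using prob_atLeast[of 0] measure_pmf.prob_space[of p] by simp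

lemma c_nonneg: "c \<ge> 0"
  using truncated_convolution_le[where k = 0 and m = 0] by (simp add: T_0)

text \<open>Induction on the number of summands: either the new coordinate alone reaches
  \<open>m\<close>, at cost \<open>T m\<close>, or it lies in \<open>{0..m}\<close> and the
  untruncated convolution bound applies to it and the rest.\<close>

lemma prob_sum_le:
  fixes A :: "nat set"
  assumes "finite A"
  shows "\<exists>C\<ge>0. \<forall>m. measure_pmf.prob (Pi_pmf A 0 (\<lambda>_. p)) {\<omega>. m \<le> sum \<omega> A} \<le> C * T m"
  using assms
proof (induction A)
  case empty
  have "measure_pmf.prob (Pi_pmf {} 0 (\<lambda>_. p)) {\<omega>. m \<le> sum \<omega> {}} \<le> 1 * T m" for m
    using T_pos[of m] by (cases "m = 0") (auto simp: T_0)
  then show ?case using zero_le_one by blast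
next
  case (insert j A)
  then obtain C where C: "C \<ge> 0"
    and G: "measure_pmf.prob (Pi_pmf A 0 (\<lambda>_. p)) {\<omega>. m \<le> sum \<omega> A} \<le> C * T m" for m
    by blast
  let ?P = "Pi_pmf (insert j A) 0 (\<lambda>_. p)"
  have "measure_pmf.prob ?P {\<omega>. m \<le> sum \<omega> (insert j A)} \<le> (1 + C * c) * T m" for m
  proof -
    let ?B = "{\<omega>. \<omega> j \<in> {0..m} \<and> m \<le> sum \<omega> (insert j A)}" and ?B' = "{\<omega>. m \<le> \<omega> j}"
    have "measure_pmf.prob ?P {\<omega>. m \<le> sum \<omega> (insert j A)} \<le> measure_pmf.prob ?P (?B \<union> ?B')"
      by (rule measure_pmf.finite_measure_mono) auto
    also have "\<dots> \<le> measure_pmf.prob ?P ?B + measure_pmf.prob ?P ?B'"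
      by (rule measure_Un_le) auto
    also have "measure_pmf.prob ?P ?B' = T m"
      using prob_atLeast[of m] Pi_pmf_component[of "insert j A" j 0 "\<lambda>_. p"] insert.hyps
        measure_map_pmf[of "\<lambda>f. f j" ?P "{m..}"]
      by (simp add: vimage_def)
    also have "measure_pmf.prob ?P ?B \<le> (\<Sum>i\<in>{0..m}. T i * (C * T (m - i)))"
      by (rule prob_Pi_pmf_sum_one_coordinate_le) (use insert.hyps G prob_atLeast in auto)
    \<comment> \<open>Writing \<open>m-0\<close> puts the sum into the shape of the locale
      assumption at \<open>k = 0\<close>.\<close>
    also have "\<dots> = C * (\<Sum>i\<in>{0..m-0}. T i * T (m - i))"
      by (simp add: sum_distrib_left mult_ac)
    also have "\<dots> \<le> C * (c / (1 + real 0) * T m)"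
      by (intro mult_left_mono truncated_convolution_le C)
    finally show ?thesis by (simp add: algebra_simps)
  qed
  with C c_nonneg show ?case by (intro exI[of _ "1 + C * c"]) auto
qed

text \<open>If the sum reaches \<open>m\<close> and \<open>n * k \<le> m\<close>, some coordinate is
  at least \<open>k\<close>; since no coordinate exceeds \<open>m - k\<close>, that one lies in
  \<open>{k..m-k}\<close>. A union bound over its position reduces to the truncated convolution,
  with \<open>prob_sum_le\<close> controlling the other coordinates.\<close>

lemma prob_sum_and_no_large_coordinate_le:
  assumes "n \<ge> 1"
  shows "\<exists>C\<ge>0. \<forall>k m. n * k \<le> m \<longrightarrow>
    measure_pmf.prob (Pi_pmf {..<n} 0 (\<lambda>_. p)) {\<omega>. m \<le> sum \<omega> {..<n} \<and> (\<forall>i<n. \<omega> i \<le> m - k)}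
      \<le> C / (1 + real k) * T m"
proof -
  have "\<forall>j. \<exists>C\<ge>0. \<forall>m. measure_pmf.prob (Pi_pmf ({..<n} - {j}) 0 (\<lambda>_. p))
      {\<omega>. m \<le> sum \<omega> ({..<n} - {j})} \<le> C * T m"
    by (intro allI prob_sum_le) auto
  then obtain C where C: "C j \<ge> 0"
    and G: "measure_pmf.prob (Pi_pmf ({..<n} - {j}) 0 (\<lambda>_. p)) {\<omega>. m \<le> sum \<omega> ({..<n} - {j})} \<le> C j * T m"
    for j m by metis
  let ?P = "Pi_pmf {..<n} 0 (\<lambda>_. p)"
  have "measure_pmf.prob ?P {\<omega>. m \<le> sum \<omega> {..<n} \<and> (\<forall>i<n. \<omega> i \<le> m - k)}
      \<le> (\<Sum>j<n. C j * c) / (1 + real k) * T m" if "n * k \<le> m" for k m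
  proof -
    let ?B = "\<lambda>j. {\<omega>. \<omega> j \<in> {k..m-k} \<and> m \<le> sum \<omega> {..<n}}"
    have sub: "{\<omega>. m \<le> sum \<omega> {..<n} \<and> (\<forall>i<n. \<omega> i \<le> m - k)} \<subseteq> (\<Union>j\<in>{..<n}. ?B j)"
    proof safe
      fix \<omega> :: "nat \<Rightarrow> nat" assume m: "m \<le> sum \<omega> {..<n}" and le: "\<forall>i<n. \<omega> i \<le> m - k"
      have "\<exists>j<n. k \<le> \<omega> j"
      proof (rule ccontr)
        assume "\<not> (\<exists>j<n. k \<le> \<omega> j)"
        then have "sum \<omega> {..<n} < (\<Sum>j<n. k)"
          using assms by (intro sum_strict_mono) (auto simp: not_le lessThan_empty_iff)
        with m that show False by simp
      qed
      with m le show "\<omega> \<in> (\<Union>j\<in>{..<n}. ?B j)" by auto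
    qed
    have "measure_pmf.prob ?P {\<omega>. m \<le> sum \<omega> {..<n} \<and> (\<forall>i<n. \<omega> i \<le> m - k)}
        \<le> measure_pmf.prob ?P (\<Union>j\<in>{..<n}. ?B j)"
      by (rule measure_pmf.finite_measure_mono[OF sub]) simp
    also have "\<dots> \<le> (\<Sum>j<n. measure_pmf.prob ?P (?B j))"
      by (rule measure_UNION_le) auto
    also have "\<dots> \<le> (\<Sum>j<n. C j * (c / (1 + real k) * T m))"
    proof (rule sum_mono)
      fix j assume "j \<in> {..<n}"
      then have ins: "insert j ({..<n} - {j}) = {..<n}" by auto
      have "measure_pmf.prob ?P (?B j) \<le> (\<Sum>i\<in>{k..m-k}. T i * (C j * T (m - i)))"
        using prob_Pi_pmf_sum_one_coordinate_le[of "{..<n} - {j}" j p "\<lambda>m. C j * T m" T "{k..m-k}" m]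
        unfolding ins using G prob_atLeast by simp
      also have "\<dots> = C j * (\<Sum>i\<in>{k..m-k}. T i * T (m - i))"
        by (simp add: sum_distrib_left mult_ac)
      also have "\<dots> \<le> C j * (c / (1 + real k) * T m)"
        by (intro mult_left_mono truncated_convolution_le C)
      finally show "measure_pmf.prob ?P (?B j) \<le> C j * (c / (1 + real k) * T m)" .
    qed
    also have "\<dots> = (\<Sum>j<n. C j * c) / (1 + real k) * T m"
      by (simp add: sum_distrib_left sum_distrib_right sum_divide_distrib mult_ac)
    finally show ?thesis .
  qed
  moreover have "(\<Sum>j<n. C j * c) \<ge> 0" using C c_nonneg by (intro sum_nonneg) auto
  ultimately show ?thesis by blast
qed

lemma le_prob_sum:
  fixes n :: nat
  assumes "n \<ge> 1"
  shows "T m \<le> measure_pmf.prob (Pi_pmf {..<n} 0 (\<lambda>_. p)) {\<omega>. m \<le> sum \<omega> {..<n}}"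
proof -
  let ?P = "Pi_pmf {..<n} 0 (\<lambda>_. p)"
  have "T m = measure_pmf.prob ?P {\<omega>. m \<le> \<omega> 0}"
    using prob_atLeast[of m] Pi_pmf_component[of "{..<n}" 0 0 "\<lambda>_. p"] assms
      measure_map_pmf[of "\<lambda>f. f 0" ?P "{m..}"]
    by (simp add: vimage_def)
  also have "\<dots> \<le> measure_pmf.prob ?P {\<omega>. m \<le> sum \<omega> {..<n}}"
  proof (rule measure_pmf.finite_measure_mono, safe)
    fix \<omega> :: "nat \<Rightarrow> nat" assume "m \<le> \<omega> 0"
    also have "\<omega> 0 \<le> sum \<omega> {..<n}" using assms by (intro member_le_sum) auto
    finally show "m \<le> sum \<omega> {..<n}" .
  qed simp
  finally show ?thesis .
qed

text \<open>The coordinates under \<open>Pi_pmf\<close> form another i.i.d. family with law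
  \<open>lattice_law p\<close>, so the conditional probability can be computed in the discrete model
  where the preceding estimates live.\<close>

lemma max_given_sum_prob_lattice_law:
  assumes "n \<ge> 1"
  shows "max_given_sum_prob (lattice_law p) n a x
    = \<P>(\<omega> in Pi_pmf {..<n} 0 (\<lambda>_. p). Max ((\<lambda>i. real (\<omega> i)) ` {..<n}) > a \<bar> (\<Sum>i<n. real (\<omega> i)) > x)"
proof (rule prob_space.iid_max_given_sum_prob[symmetric])
  let ?P = "Pi_pmf {..<n} 0 (\<lambda>_. p)"
  show "prob_space (measure_pmf ?P)" by (rule measure_pmf.prob_space_axioms)
  show "n > 0" using assms by simp
  have "prob_space.indep_vars (measure_pmf ?P) (\<lambda>_. borel) (\<lambda>i. real \<circ> (\<lambda>\<omega>. \<omega> i)) {..<n}"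
    by (rule prob_space.indep_vars_compose[OF measure_pmf.prob_space_axioms indep_vars_Pi_pmf]) auto
  then show "prob_space.indep_vars (measure_pmf ?P) (\<lambda>_. borel) (\<lambda>i \<omega>. real (\<omega> i)) {..<n}"
    by (simp add: comp_def)
  fix i assume "i < n"
  then have "map_pmf (\<lambda>\<omega>. \<omega> i) ?P = p"
    using Pi_pmf_component[of "{..<n}" i 0 "\<lambda>_. p"] by simp
  then have "lattice_law p = distr (distr (measure_pmf ?P) (count_space UNIV) (\<lambda>\<omega>. \<omega> i)) borel real"
    unfolding lattice_law_def by (metis map_pmf_rep_eq)
  also have "\<dots> = distr (measure_pmf ?P) borel (\<lambda>\<omega>. real (\<omega> i))"
    by (subst distr_distr) (auto simp: comp_def)
  finally show "distr (measure_pmf ?P) borel (\<lambda>\<omega>. real (\<omega> i)) = lattice_law p" ..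
qed

text \<open>On the event that the sum exceeds \<open>x\<close>, failure of the maximum to exceed
  \<open>a\<close> keeps every coordinate at most \<open>m - k\<close>. That failure has probability
  at most \<open>C / (1 + real k) * T m\<close>, and the conditioning event has probability at least
  \<open>T m\<close>.\<close>

lemma max_given_sum_prob_bounds:
  assumes "n \<ge> 1"
  obtains C where "C \<ge> 0" and "\<And>k a x. \<lbrakk>real (n * k) \<le> x; a + real k \<le> x\<rbrakk> \<Longrightarrow>
    1 - C / (1 + real k) \<le> max_given_sum_prob (lattice_law p) n a x"
proof -
  obtain C where "C \<ge> 0" and C: "n * k \<le> m \<Longrightarrow>
    measure_pmf.prob (Pi_pmf {..<n} 0 (\<lambda>_. p)) {\<omega>. m \<le> sum \<omega> {..<n} \<and> (\<forall>i<n. \<omega> i \<le> m - k)}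
      \<le> C / (1 + real k) * T m" for k m
    using prob_sum_and_no_large_coordinate_le[OF assms] by blast
  show thesis
  proof (rule that[OF \<open>C \<ge> 0\<close>])
    fix k a x assume x: "real (n * k) \<le> x" and a: "a + real k \<le> x"
    let ?P = "Pi_pmf {..<n} 0 (\<lambda>_. p)"
    \<comment> \<open>The least natural number strictly above \<open>x\<close>; an integer sum
      exceeds \<open>x\<close> exactly when it reaches \<open>m\<close>.\<close>
    define m where "m = nat \<lfloor>x\<rfloor> + 1"
    have "0 \<le> x" using x by (meson of_nat_0_le_iff order_trans)
    have ge_m: "m \<le> l \<longleftrightarrow> x < real l" for l
      unfolding m_def using \<open>0 \<le> x\<close> by (auto simp: Suc_le_eq nat_less_iff floor_less_iff)
    have nk: "n * k \<le> m"
      using x unfolding m_def by (simp add: le_nat_floor trans_le_add1 le_SucI)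
    let ?M = "\<lambda>\<omega>. Max ((\<lambda>i. real (\<omega> i)) ` {..<n})"
    let ?S = "{\<omega>. m \<le> sum \<omega> {..<n}}" and ?E = "{\<omega>. m \<le> sum \<omega> {..<n} \<and> (\<forall>i<n. \<omega> i \<le> m - k)}"
    have S: "{\<omega>. x < (\<Sum>i<n. real (\<omega> i))} = ?S"
      using ge_m[symmetric] by (simp flip: of_nat_sum)
    have S_pos: "T m \<le> measure_pmf.prob ?P ?S" "0 < measure_pmf.prob ?P ?S"
      using le_prob_sum[OF assms, of m] T_pos[of m] by auto
    have "?S \<subseteq> {\<omega>. a < ?M \<omega> \<and> m \<le> sum \<omega> {..<n}} \<union> ?E"
    proof
      fix \<omega> assume S: "\<omega> \<in> ?S"
      have "\<omega> i \<le> m - k" if na: "\<not> a < ?M \<omega>" and i: "i < n" for i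
      proof -
        have "real (\<omega> i) \<le> ?M \<omega>" using i by (intro Max_ge) auto
        then have "real (\<omega> i + k) \<le> x" using na a by simp
        then have "\<omega> i + k < m" using ge_m[of "\<omega> i + k"] by linarith
        then show ?thesis by simp
      qed
      with S show "\<omega> \<in> {\<omega>. a < ?M \<omega> \<and> m \<le> sum \<omega> {..<n}} \<union> ?E" by blast
    qed
    then have "measure_pmf.prob ?P ?S
        \<le> measure_pmf.prob ?P ({\<omega>. a < ?M \<omega> \<and> m \<le> sum \<omega> {..<n}} \<union> ?E)"
      by (rule measure_pmf.finite_measure_mono) simp
    also have "\<dots> \<le> measure_pmf.prob ?P {\<omega>. a < ?M \<omega> \<and> m \<le> sum \<omega> {..<n}} + measure_pmf.prob ?P ?E"
      by (rule measure_Un_le) auto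
    also have "measure_pmf.prob ?P ?E \<le> C / (1 + real k) * T m"
      by (rule C[OF nk])
    also have "\<dots> \<le> C / (1 + real k) * measure_pmf.prob ?P ?S"
      using \<open>C \<ge> 0\<close> S_pos by (intro mult_left_mono) auto
    finally have "(1 - C / (1 + real k)) * measure_pmf.prob ?P ?S
        \<le> measure_pmf.prob ?P {\<omega>. a < ?M \<omega> \<and> m \<le> sum \<omega> {..<n}}"
      by (simp add: algebra_simps)
    then have "1 - C / (1 + real k)
        \<le> measure_pmf.prob ?P {\<omega>. a < ?M \<omega> \<and> m \<le> sum \<omega> {..<n}} / measure_pmf.prob ?P ?S"
      using S_pos by (simp add: pos_le_divide_eq)
    also have "\<dots> = max_given_sum_prob (lattice_law p) n a x"
    proof -
      have "{\<omega>. a < ?M \<omega> \<and> m \<le> sum \<omega> {..<n}} = {\<omega>. a < ?M \<omega> \<and> x < (\<Sum>i<n. real (\<omega> i))}"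
        using S by blast
      then show ?thesis
        unfolding max_given_sum_prob_lattice_law[OF assms] cond_prob_def by (simp add: S)
    qed
    finally show "1 - C / (1 + real k) \<le> max_given_sum_prob (lattice_law p) n a x" .
  qed
qed

text \<open>Squeeze: for each positive \<open>K\<close> the lower limit lies between
  \<open>1 - C / K\<close> and 1. The lower bound uses \<open>max_given_sum_prob_bounds\<close> with
  \<open>k\<close> the integer part of \<open>K\<close> and \<open>a = x - K\<close>.\<close>

lemma lattice_law_class_J: "lattice_law p \<in> class_J"
proof -
  let ?F = "lattice_law p"
  have "((\<lambda>K. Liminf at_top (\<lambda>x. ereal (max_given_sum_prob ?F n (x - K) x))) \<longlongrightarrow> 1) at_top"
    if "n \<ge> 2" for n
  proof -
    have "n \<ge> 1" using that by simp
    then obtain C where "C \<ge> 0" and C: "\<lbrakk>real (n * k) \<le> x; a + real k \<le> x\<rbrakk> \<Longrightarrow>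
        1 - C / (1 + real k) \<le> max_given_sum_prob ?F n a x" for k a x
      using max_given_sum_prob_bounds by metis
    have "((\<lambda>K::real. 1 - C / K) \<longlongrightarrow> 1) at_top"
      by real_asymp
    then have lim: "((\<lambda>K::real. ereal (1 - C / K)) \<longlongrightarrow> 1) at_top"
      by (simp add: one_ereal_def)
    show ?thesis
    proof (rule tendsto_sandwich[OF _ _ lim tendsto_const])
      show "\<forall>\<^sub>F K in at_top. ereal (1 - C / K)
          \<le> Liminf at_top (\<lambda>x. ereal (max_given_sum_prob ?F n (x - K) x))"
        using eventually_gt_at_top[of 0]
      proof eventually_elim
        case (elim K)
        define k where "k = nat \<lfloor>K\<rfloor>"
        have k: "real k \<le> K" "K \<le> 1 + real k" using elim by (auto simp: k_def) linarith
        have "1 - C / K \<le> 1 - C / (1 + real k)"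
          using elim k \<open>C \<ge> 0\<close> by (auto intro!: divide_left_mono)
        moreover have "1 - C / (1 + real k) \<le> max_given_sum_prob ?F n (x - K) x"
          if "x \<ge> real (n * k)" for x
          using that k by (intro C) auto
        ultimately show ?case
          by (intro Liminf_bounded eventually_mono[OF eventually_ge_at_top[of "real (n * k)"]])
            (meson ereal_less_eq(3) order_trans)
      qed
      show "\<forall>\<^sub>F K in at_top. Liminf at_top (\<lambda>x. ereal (max_given_sum_prob ?F n (x - K) x)) \<le> 1"
      proof (intro always_eventually allI)
        fix K
        have "max_given_sum_prob ?F n (x - K) x \<le> 1" for x
          unfolding max_given_sum_prob_lattice_law[OF \<open>n \<ge> 1\<close>] cond_prob_def
          by (rule divide_le_eq_1[THEN iffD2]) (auto simp: less_le intro!: measure_pmf.finite_measure_mono)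
        then have "Liminf at_top (\<lambda>x. ereal (max_given_sum_prob ?F n (x - K) x))
            \<le> Liminf (at_top :: real filter) (\<lambda>_. 1)"
          by (intro Liminf_mono always_eventually) (simp flip: one_ereal_def)
        then show "Liminf at_top (\<lambda>x. ereal (max_given_sum_prob ?F n (x - K) x)) \<le> 1"
          by (simp add: Liminf_const)
      qed
    qed
  qed
  moreover have "?F \<in> nonneg_unbounded_distributions"
    by (rule lattice_law_nonneg_unbounded) (simp add: prob_atLeast T_pos)
  ultimately show ?thesis by (simp add: class_J_def)
qed

end


subsection \<open>Exponential decay with a delay\<close>

text \<open>The fourth power leaves room for the delay: after \<open>exp (D m)\<close> has used up
  two powers, a summable inverse square remains.\<close>

definition delayed_decay :: "(nat \<Rightarrow> real) \<Rightarrow> nat \<Rightarrow> real" where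
  "delayed_decay D m = exp (D m - real m) / (1 + real m) ^ 4"

text \<open>Each term is at most \<open>2 / ((1 + i) * (2 + i))\<close>, which telescopes.\<close>

lemma sum_inverse_square_le:
  assumes "k \<le> n"
  shows "(\<Sum>i\<in>{k..n}. 1 / (1 + real i)^2) \<le> 2 / (1 + real k)"
proof -
  have "(\<Sum>i\<in>{k..n}. 1 / (1 + real i)^2) \<le> (\<Sum>i\<in>{k..n}. 2 / (1 + real i) - 2 / (1 + real (Suc i)))"
  proof (rule sum_mono)
    fix i
    have "1 / (1 + real i)^2 \<le> 2 / ((1 + real i) * (1 + real (Suc i)))"
      by (simp add: frac_le_eq divide_simps power2_eq_square)
    also have "\<dots> = 2 / (1 + real i) - 2 / (1 + real (Suc i))"
      by (simp add: field_simps)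
    finally show "1 / (1 + real i)^2 \<le> 2 / (1 + real i) - 2 / (1 + real (Suc i))" .
  qed
  also have "\<dots> = 2 / (1 + real k) - 2 / (1 + real (Suc n))"
    using sum_Suc_diff[of k n "\<lambda>i. - (2 / (1 + real i))"] assms by simp
  also have "\<dots> \<le> 2 / (1 + real k)" by simp
  finally show ?thesis .
qed

text \<open>\<open>D_Suc_le\<close> keeps the delayed tail nonincreasing. \<open>D_Suc_ge\<close>
  and \<open>exp_D_le\<close> serve the convolution estimate: the former absorbs the delay of the
  larger summand, the latter that of the smaller one.\<close>

locale delay =
  fixes D :: "nat \<Rightarrow> real"
  assumes D_0: "D 0 = 0"
    and D_Suc_ge: "\<And>m. D m \<le> D (Suc m)"
    and D_Suc_le: "\<And>m. D (Suc m) \<le> D m + 1"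
    and exp_D_le: "\<And>m. exp (D m) \<le> (1 + real m)^2"
begin

abbreviation "T \<equiv> delayed_decay D"

lemma D_mono: "i \<le> j \<Longrightarrow> D i \<le> D j"
  using D_Suc_ge by (rule lift_Suc_mono_le)

lemma T_pos: "T m > 0"
  by (simp add: delayed_decay_def zero_less_power)

lemma T_0: "T 0 = 1"
  by (simp add: delayed_decay_def D_0)

lemma T_dec: "T (Suc m) \<le> T m"
  unfolding delayed_decay_def using D_Suc_le[of m]
  by (intro frac_le power_mono) (auto simp: zero_less_power)

lemma T_le_exp: "T m \<le> exp (- real m)"
proof -
  have "T m = exp (D m) / (1 + real m)^4 * exp (- real m)"
    by (simp add: delayed_decay_def exp_diff exp_minus field_simps)
  also have "exp (D m) / (1 + real m)^4 \<le> 1"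
  proof -
    have "exp (D m) \<le> (1 + real m)^2" by (rule exp_D_le)
    also have "\<dots> \<le> (1 + real m)^4" by (intro power_increasing) auto
    finally show ?thesis by (simp add: divide_le_eq)
  qed
  finally show ?thesis by simp
qed

text \<open>The exponentials of \<open>- i\<close> and \<open>- l\<close> multiply exactly. For the
  delays, \<open>exp (D i)\<close> is at most \<open>(1 + i)^2\<close> and
  \<open>D l \<le> D (i + l)\<close>. Since \<open>i \<le> l\<close>, \<open>1 + i + l\<close> is at
  most twice \<open>1 + l\<close>, whose fourth power yields the constant 16.\<close>

lemma T_mult_le_aux:
  assumes "i \<le> l"
  shows "T i * T l \<le> 16 * T (i + l) * (1 / (1 + real i)^2)"
proof -
  have "T i * T l = exp (D i) * exp (D l) * exp (- real (i + l)) / ((1 + real i)^4 * (1 + real l)^4)"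
    by (simp add: delayed_decay_def exp_diff exp_minus exp_add field_simps)
  also have "\<dots> \<le> (1 + real i)^2 * exp (D (i + l)) * exp (- real (i + l)) / ((1 + real i)^4 * ((1 + real (i + l))^4 / 16))"
  proof (rule frac_le)
    have "(1 + real (i + l))^4 \<le> (2 * (1 + real l))^4"
      using assms by (intro power_mono) auto
    also have "\<dots> = 16 * (1 + real l)^4"
      unfolding power_mult_distrib by simp
    finally show "(1 + real i)^4 * ((1 + real (i + l))^4 / 16) \<le> (1 + real i)^4 * (1 + real l)^4"
      by (intro mult_left_mono) auto
    show "exp (D i) * exp (D l) * exp (- real (i + l)) \<le> (1 + real i)^2 * exp (D (i + l)) * exp (- real (i + l))"
      using exp_D_le[of i] D_mono[of l "i + l"] by (intro mult_mono) auto
    show "0 < (1 + real i)^4 * ((1 + real (i + l))^4 / 16)"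
      by (intro mult_pos_pos divide_pos_pos zero_less_power) auto
  qed auto
  also have "\<dots> = 16 * T (i + l) * (1 / (1 + real i)^2)"
  proof -
    have nz: "1 + real i \<noteq> 0" "1 + real (i + l) \<noteq> 0" by linarith+
    have "(1 + real i)^4 = (1 + real i)^2 * (1 + real i)^2" by (simp flip: power_add)
    with nz show ?thesis
      unfolding delayed_decay_def exp_diff exp_minus by (simp add: divide_simps)
  qed
  finally show ?thesis .
qed

text \<open>Adding the bounds for both orders of \<open>i\<close> and \<open>m - i\<close> gives one
  estimate that can be summed without a case distinction.\<close>

lemma T_mult_le:
  assumes "i \<le> m"
  shows "T i * T (m - i) \<le> 16 * T m * (1 / (1 + real i)^2 + 1 / (1 + real (m - i))^2)"
proof (cases "i \<le> m - i")
  case True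
  have "T i * T (m - i) \<le> 16 * T m * (1 / (1 + real i)^2)"
    using T_mult_le_aux[OF True] assms by simp
  also have "\<dots> \<le> 16 * T m * (1 / (1 + real i)^2 + 1 / (1 + real (m - i))^2)"
    using T_pos[of m] by (intro mult_left_mono) auto
  finally show ?thesis .
next
  case False
  have "T i * T (m - i) \<le> 16 * T m * (1 / (1 + real (m - i))^2)"
    using T_mult_le_aux[of "m - i" i] False assms by (simp add: mult.commute)
  also have "\<dots> \<le> 16 * T m * (1 / (1 + real i)^2 + 1 / (1 + real (m - i))^2)"
    using T_pos[of m] by (intro mult_left_mono) auto
  finally show ?thesis .
qed

text \<open>The reflection \<open>i \<mapsto> m - i\<close> preserves the range, so both
  inverse-square sums coincide and each is at most \<open>2 / (1 + k)\<close>; hence 64 = 16 * (2 +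
  2).\<close>

lemma truncated_convolution_T_le:
  "(\<Sum>i\<in>{k..m-k}. T i * T (m - i)) \<le> 64 / (1 + real k) * T m"
proof (cases "k \<le> m - k")
  case True
  let ?q = "\<lambda>i. 1 / (1 + real i)^2"
  have "(\<Sum>i\<in>{k..m-k}. T i * T (m - i)) \<le> (\<Sum>i\<in>{k..m-k}. 16 * T m * (?q i + ?q (m - i)))"
    using T_mult_le by (intro sum_mono) auto
  also have "\<dots> = 16 * T m * ((\<Sum>i\<in>{k..m-k}. ?q i) + (\<Sum>i\<in>{k..m-k}. ?q (m - i)))"
    by (simp only: sum.distrib[symmetric] sum_distrib_left[symmetric])
  also have "(\<Sum>i\<in>{k..m-k}. ?q (m - i)) = (\<Sum>i\<in>{k..m-k}. ?q i)"
    by (rule sum.reindex_bij_witness[of _ "\<lambda>i. m - i" "\<lambda>i. m - i"]) (use True in auto)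
  also have "16 * T m * ((\<Sum>i\<in>{k..m-k}. ?q i) + (\<Sum>i\<in>{k..m-k}. ?q i))
      \<le> 16 * T m * (2 / (1 + real k) + 2 / (1 + real k))"
    using T_pos[of m] sum_inverse_square_le[OF True] by (intro mult_left_mono add_mono) auto
  also have "2 / (1 + real k) + 2 / (1 + real k) = 4 / (1 + real k)"
    by (simp flip: add_divide_distrib)
  also have "16 * T m * \<dots> = 64 / (1 + real k) * T m" by simp
  finally show ?thesis .
next
  case False
  then show ?thesis using T_pos[of m] by simp
qed

lemma exists_pmf:
  obtains p where "lattice_tail p T 64"
proof -
  have "(\<lambda>m. exp (- real m)) \<longlonglongrightarrow> 0" by real_asymp
  from tendsto_sandwich[OF always_eventually always_eventually tendsto_const this]
  have "T \<longlonglongrightarrow> 0"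
    using T_pos T_le_exp by (auto intro: less_imp_le)
  from exists_pmf_with_tail[OF T_0 T_dec this]
  obtain p where "\<And>m. measure_pmf.prob p {m..} = T m" by blast
  then have "lattice_tail p T 64"
    by (intro lattice_tail.intro T_pos truncated_convolution_T_le)
  then show thesis by (rule that)
qed

text \<open>The mass at \<open>n\<close> is at most \<open>exp (- n)\<close>, so the exponential
  moment of order 1/2 is dominated by a geometric series with ratio
  \<open>exp (-1/2)\<close>.\<close>

lemma lattice_law_light_tailed:
  assumes "lattice_tail p T 64"
  shows "lattice_law p \<in> class_Kc"
proof -
  interpret lattice_tail p T 64 by fact
  have "exp_moment (lattice_law p) (1/2) = (\<integral>\<^sup>+n. ennreal (exp (1/2 * real n)) \<partial>measure_pmf p)"
    unfolding exp_moment_def lattice_law_def by (subst nn_integral_distr) auto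
  also have "\<dots> = (\<integral>\<^sup>+n. ennreal (pmf p n) * ennreal (exp (1/2 * real n)) \<partial>count_space UNIV)"
    by (rule nn_integral_measure_pmf)
  also have "\<dots> \<le> (\<integral>\<^sup>+n. ennreal (exp (-1/2) ^ n) \<partial>count_space UNIV)"
  proof (rule nn_integral_mono)
    fix n
    have "pmf p n \<le> measure_pmf.prob p {n..}"
      unfolding measure_pmf_single[symmetric] by (rule measure_pmf.finite_measure_mono) auto
    also have "\<dots> \<le> exp (- real n)"
      using T_le_exp by (simp add: prob_atLeast)
    finally have "pmf p n * exp (1/2 * real n) \<le> exp (- real n) * exp (1/2 * real n)"
      by (intro mult_right_mono) auto
    also have "\<dots> = exp (-1/2) ^ n"
      by (simp add: exp_add[symmetric] exp_of_nat_mult[symmetric])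
    finally show "ennreal (pmf p n) * ennreal (exp (1/2 * real n)) \<le> ennreal (exp (-1/2) ^ n)"
      by (simp flip: ennreal_mult add: ennreal_leI)
  qed
  also have "\<dots> = (\<Sum>n. ennreal (exp (-1/2) ^ n))"
    by (rule nn_integral_count_space_nat)
  also have "\<dots> < \<infinity>"
    using summable_geometric[of "exp (-1/2 :: real)"] by (subst suminf_ennreal2) auto
  finally have "exp_moment (lattice_law p) (1/2) \<noteq> \<infinity>" by simp
  moreover have "lattice_law p \<in> nonneg_unbounded_distributions"
    using lattice_law_class_J by (simp add: class_J_def)
  ultimately show ?thesis
    unfolding class_Kc_def class_K_def by (auto intro!: exI[of _ "1/2"])
qed

lemma lattice_law_not_class_S:
  assumes "lattice_tail p T 64" "\<beta> \<ge> 0"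
  shows "lattice_law p \<notin> class_S \<beta>"
proof (cases "\<beta> = 0")
  case True
  then show ?thesis
    using subexponential_not_light_tailed lattice_law_light_tailed[OF assms(1)]
    by (auto simp: class_S_def)
next
  case False
  then show ?thesis using assms(2) lattice_law_not_class_L[of \<beta> p] by (simp add: class_S_def)
qed

end

section \<open>A delay with arbitrarily long runs of unit steps\<close>

text \<open>
  The \<open>k\<close>-th term starts growing at \<open>2^2^k\<close>, so late that \<open>exp (2^k)\<close> is below the square of that
  argument; it overtakes the earlier terms with a run of \<open>2^(k-1)\<close> unit steps, on which
  the delayed tail decays only polynomially.
\<close>

definition plateau_delay :: "nat \<Rightarrow> real" where
  "plateau_delay m = (SUP k. real (min (2^k) (m - 2^2^k)))"

lemma plateau_delay_bdd: "bdd_above (range (\<lambda>k. real (min (2^k) (m - 2^2^k))))"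
  by (rule bdd_aboveI[of _ "real m"]) auto

lemma le_plateau_delay: "real (min (2^k) (m - 2^2^k)) \<le> plateau_delay m"
  unfolding plateau_delay_def by (rule cSUP_upper[OF UNIV_I plateau_delay_bdd])

lemma plateau_delay_le:
  "(\<And>k. real (min (2^k) (m - 2^2^k)) \<le> b) \<Longrightarrow> plateau_delay m \<le> b"
  unfolding plateau_delay_def by (rule cSUP_least) auto

text \<open>Each term of the supremum starts at 0, is nondecreasing with steps at most 1 and obeys
  the logarithmic bound; all four properties pass to the supremum.\<close>

lemma plateau_delay: "delay plateau_delay"
proof
  show "plateau_delay 0 = 0" by (simp add: plateau_delay_def)
  fix m
  show "plateau_delay m \<le> plateau_delay (Suc m)"
  proof (rule plateau_delay_le)
    fix k
    have "real (min (2^k) (m - 2^2^k)) \<le> real (min (2^k) (Suc m - 2^2^k))" by simp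
    also have "\<dots> \<le> plateau_delay (Suc m)" by (rule le_plateau_delay)
    finally show "real (min (2^k) (m - 2^2^k)) \<le> plateau_delay (Suc m)" .
  qed
  show "plateau_delay (Suc m) \<le> plateau_delay m + 1"
  proof (rule plateau_delay_le)
    fix k
    have "real (min (2^k) (Suc m - 2^2^k)) \<le> real (min (2^k) (m - 2^2^k)) + 1" by linarith
    also have "real (min (2^k) (m - 2^2^k)) \<le> plateau_delay m" by (rule le_plateau_delay)
    finally show "real (min (2^k) (Suc m - 2^2^k)) \<le> plateau_delay m + 1" by simp
  qed
  have "plateau_delay m \<le> ln ((1 + real m)^2)"
  proof (rule plateau_delay_le)
    fix k
    let ?d = "min (2^k) (m - 2^2^k)"
    have "exp (real ?d) \<le> (1 + real m)^2"
    proof (cases "?d = 0")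
      case False
      have "exp (real ?d) \<le> exp (real (2^k))" by simp
      also have "\<dots> = exp 1 ^ (2^k)" by (simp flip: exp_of_nat_mult)
      \<comment> \<open>The base 4 is chosen above \<open>exp 1\<close> and because
        \<open>4 ^ (2^k)\<close> is the square of the starting point \<open>2^2^k\<close>, which is
        at most \<open>m\<close> once the term is nonzero.\<close>
      also have "\<dots> \<le> 4 ^ (2^k)" using exp_le by (intro power_mono) auto
      also have "\<dots> = (real (2^2^k))^2"
      proof -
        have "(4 :: real) ^ (2^k) = (2^2) ^ (2^k)" by simp
        also have "\<dots> = (2 ^ (2^k))^2" by (simp only: power_mult[symmetric] mult.commute)
        finally show ?thesis by simp
      qed
      also have "\<dots> \<le> (1 + real m)^2"
      proof (rule power_mono)
        have "2^2^k \<le> m" using False by auto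
        then have "real (2^2^k) \<le> real m" by (rule of_nat_mono)
        then show "real (2^2^k) \<le> 1 + real m" by linarith
      qed simp
      finally show ?thesis .
    qed (simp add: one_le_power)
    then show "real ?d \<le> ln ((1 + real m)^2)"
      by (subst ln_ge_iff) (auto simp: zero_less_power)
  qed
  then have "exp (plateau_delay m) \<le> exp (ln ((1 + real m)^2))"
    unfolding exp_le_cancel_iff .
  also have "\<dots> = (1 + real m)^2" by (intro exp_ln zero_less_power) auto
  finally show "exp (plateau_delay m) \<le> (1 + real m)^2" .
qed

text \<open>At \<open>m\<close> the term of index \<open>Suc k\<close> has just climbed to
  \<open>2^k\<close>. Earlier terms are capped at that height and later ones have not started, so
  the supremum is at most \<open>2^k\<close> there. The term of index \<open>Suc k\<close> has cap
  \<open>2^Suc k\<close> and can rise for \<open>2^k\<close> further unit steps.\<close>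

lemma plateau_delay_runs:
  assumes "t \<le> 2^k" and m: "m = 2^2^Suc k + 2^k"
  shows "plateau_delay (m + t) = plateau_delay m + real t"
proof -
  interpret delay plateau_delay by (rule plateau_delay)
  have upper: "plateau_delay (m + t) \<le> plateau_delay m + real t"
  proof (induction t)
    case (Suc t)
    with D_Suc_le[of "m + t"] show ?case by simp
  qed simp
  have "plateau_delay m \<le> 2^k"
  proof (rule plateau_delay_le)
    fix j
    consider "j \<le> k" | "j = Suc k" | "Suc k < j" by linarith
    then have "min (2^j) (m - 2^2^j) \<le> (2^k :: nat)"
    proof cases
      case 1
      then have "(2^j :: nat) \<le> 2^k" by (rule power_increasing) simp
      then show ?thesis by (rule min.coboundedI1)
    next
      case 2
      then show ?thesis by (simp add: m)
    next
      case 3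
      \<comment> \<open>This places \<open>m\<close> no later than the starting point of term
        \<open>j\<close>, where the truncated subtraction gives 0.\<close>
      have "m \<le> 2^2^Suc k + 2^2^Suc k"
      proof -
        have "k \<le> 2^Suc k" using less_exp[of "Suc k"] by linarith
        then have "(2^k :: nat) \<le> 2^2^Suc k" by (rule power_increasing) simp
        then show ?thesis by (simp add: m)
      qed
      also have "\<dots> = 2^(Suc (2^Suc k))" by simp
      also have "\<dots> \<le> 2^2^j"
      proof (rule power_increasing)
        have "Suc (2^Suc k) \<le> 2 * 2^Suc k" by simp
        also have "\<dots> = (2 :: nat)^Suc (Suc k)" by simp
        also have "\<dots> \<le> 2^j" using 3 by (intro power_increasing) auto
        finally show "Suc (2^Suc k) \<le> 2^j" .
      qed simp
      finally show ?thesis by simp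
    qed
    then have "real (min (2^j) (m - 2^2^j)) \<le> real (2^k)" by (rule of_nat_mono)
    then show "real (min (2^j) (m - 2^2^j)) \<le> 2^k" by simp
  qed
  moreover have "2^k + real t \<le> plateau_delay (m + t)"
    using le_plateau_delay[of "Suc k" "m + t"] assms by (simp add: m)
  ultimately show ?thesis using upper by linarith
qed


subsection \<open>A convolution equivalent law\<close>

lemma tail_borel_measurable [measurable]:
  assumes "real_distribution F"
  shows "tail F \<in> borel_measurable borel"
proof -
  interpret real_distribution F by fact
  have "cdf F \<in> borel_measurable borel"
    by (intro borel_measurable_mono monoI cdf_nondecreasing)
  then show ?thesis unfolding tail_def[abs_def] by measurable
qed

text \<open>Two summands that are both at most \<open>x/2\<close> cannot exceed \<open>x\<close>
  together. So the event splits disjointly according to whether the first is small, the second is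
  small, or both exceed \<open>x/2\<close>; the first two parts are equal by symmetry.\<close>

lemma tail_convolution_split:
  assumes rd: "real_distribution F"
  shows "tail (convolution F F) x =
    2 * (\<integral>y. indicator {..x/2} y * tail F (x - y) \<partial>F) + (tail F (x/2))\<^sup>2"
proof -
  interpret real_distribution F by fact
  interpret P: pair_prob_space F F ..
  note [measurable] = tail_borel_measurable[OF rd]
  let ?P = "F \<Otimes>\<^sub>M F" and ?h = "\<lambda>y. indicator {..x/2} y * tail F (x - y)"
  let ?A = "{(a, b). a \<le> x/2 \<and> x < a + b}" and ?B = "{(a, b). b \<le> x/2 \<and> x < a + b}"
  have "{p \<in> space ?P. fst p \<le> x/2 \<and> x < fst p + snd p} \<in> sets ?P" by measurable
  then have A: "?A \<in> sets ?P" by (simp add: space_pair_measure case_prod_unfold)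
  have "{p \<in> space ?P. snd p \<le> x/2 \<and> x < fst p + snd p} \<in> sets ?P" by measurable
  then have B: "?B \<in> sets ?P" by (simp add: space_pair_measure case_prod_unfold)
  have h_bounds: "0 \<le> ?h y" "?h y \<le> 1" for y
    using tail_eq_measure[OF rd, of "x - y"] by (auto simp: indicator_def)
  have int: "integrable F ?h"
    by (rule integrable_const_bound[of _ 1]) (use h_bounds in auto)
  have slice: "(\<integral>\<^sup>+y. emeasure F {b. y \<le> x/2 \<and> x < y + b} \<partial>F) = ennreal (integral\<^sup>L F ?h)"
  proof -
    have "emeasure F {b. y \<le> x/2 \<and> x < y + b} = ennreal (?h y)" for y
    proof (cases "y \<le> x/2")
      case True
      then have "{b. y \<le> x/2 \<and> x < y + b} = {x - y<..}" by auto
      then show ?thesis using True by (simp add: emeasure_eq_measure tail_eq_measure[OF rd])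
    qed simp
    then show ?thesis using nn_integral_eq_integral[OF int] h_bounds by simp
  qed
  have mA: "measure ?P ?A = integral\<^sup>L F ?h"
  proof -
    have "emeasure ?P ?A = (\<integral>\<^sup>+y. emeasure F (Pair y -` ?A) \<partial>F)"
      by (rule emeasure_pair_measure_alt[OF A])
    also have "\<dots> = ennreal (integral\<^sup>L F ?h)" using slice by (simp add: vimage_def)
    finally show ?thesis using h_bounds by (simp add: measure_def integral_nonneg_AE)
  qed
  have mB: "measure ?P ?B = integral\<^sup>L F ?h"
  proof -
    have "emeasure ?P ?B = (\<integral>\<^sup>+y. emeasure F ((\<lambda>x. (x, y)) -` ?B) \<partial>F)"
      by (rule P.emeasure_pair_measure_alt2[OF B])
    also have "\<dots> = ennreal (integral\<^sup>L F ?h)" using slice by (simp add: vimage_def add.commute)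
    finally show ?thesis using h_bounds by (simp add: measure_def integral_nonneg_AE)
  qed
  let ?C = "{x/2<..} \<times> {x/2<..}"
  have mC: "measure ?P ?C = (tail F (x/2))\<^sup>2"
    by (simp add: measure_def emeasure_pair_measure_Times enn2real_mult tail_eq_measure[OF rd] power2_eq_square)
  have "{(a, b). x < a + b} = ?A \<union> ?B \<union> ?C" by auto
  then have "measure ?P {(a, b). x < a + b} = measure ?P (?A \<union> ?B \<union> ?C)" by simp
  also have "\<dots> = measure ?P (?A \<union> ?B) + measure ?P ?C"
    by (rule P.finite_measure_Union) (use A B in auto)
  also have "measure ?P (?A \<union> ?B) = measure ?P ?A + measure ?P ?B"
    by (rule P.finite_measure_Union[OF A B]) auto
  finally show ?thesis unfolding tail_convolution_eq_measure[OF rd] mA mB mC by simp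
qed

text \<open>The density is minus the derivative of \<open>exp (- y) / (1 + y)^4\<close>, which
  therefore is the tail on the nonnegative half-line.\<close>

definition exp_pareto :: "real measure" where
  "exp_pareto = density lborel
     (\<lambda>y. ennreal (exp (- y) * (1 / (1 + y)^4 + 4 / (1 + y)^5)) * indicator {0..} y)"

lemma sets_exp_pareto [simp, measurable_cong]: "sets exp_pareto = sets borel"
  by (simp add: exp_pareto_def)

lemma space_exp_pareto [simp]: "space exp_pareto = UNIV"
  by (simp add: exp_pareto_def)

lemma DERIV_inverse_power_shift:
  fixes y :: real
  assumes "1 + y > 0"
  shows "DERIV (\<lambda>y. 1 / (1 + y)^n) y :> - real n / (1 + y)^Suc n"
proof -
  have "((\<lambda>y. (1 + y) powi (- int n)) has_real_derivative
      of_int (- int n) * (1 + y) powi (- int n - 1) * (0 + 1)) (at y)"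
    using assms by (intro derivative_intros) auto
  moreover have "(1 + y) powi (- int n - 1) = 1 / (1 + y)^Suc n"
  proof -
    have "- int n - 1 = - int (Suc n)" by simp
    then show ?thesis by (simp only: power_int_minus power_int_of_nat inverse_eq_divide)
  qed
  ultimately show ?thesis by (simp add: power_int_minus inverse_eq_divide)
qed

lemma emeasure_exp_pareto_atLeast:
  assumes "x \<ge> 0"
  shows "emeasure exp_pareto {x..} = ennreal (exp (- x) / (1 + x)^4)"
proof -
  let ?f = "\<lambda>y::real. exp (- y) * (1 / (1 + y)^4 + 4 / (1 + y)^5)"
  have "emeasure exp_pareto {x..} = (\<integral>\<^sup>+y. ennreal (?f y) * indicator {x..} y \<partial>lborel)"
    unfolding exp_pareto_def using assms
    by (subst emeasure_density) (auto intro!: nn_integral_cong simp: indicator_def)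
  also have "\<dots> = ennreal (0 - - (exp (- x) * (1 / (1 + x)^4)))"
  proof (rule nn_integral_FTC_atLeast)
    show "DERIV (\<lambda>y. - (exp (- y) * (1 / (1 + y)^4))) y :> ?f y" if "x \<le> y" for y
    proof -
      have "1 + y > 0" using that assms by simp
      have "DERIV (\<lambda>y. exp (- y)) y :> exp (- y) * - 1"
        by (auto intro!: derivative_eq_intros)
      from DERIV_minus[OF DERIV_mult[OF this DERIV_inverse_power_shift[OF \<open>1 + y > 0\<close>, of 4]]]
      have "DERIV (\<lambda>y. - (exp (- y) * (1 / (1 + y)^4))) y :>
          - (exp (- y) * - 1 * (1 / (1 + y)^4) + - real 4 / (1 + y)^Suc 4 * exp (- y))" .
      moreover have "- (exp (- y) * - 1 * (1 / (1 + y)^4) + - real 4 / (1 + y)^Suc 4 * exp (- y)) = ?f y"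
        by (simp add: ring_distribs del: power_Suc)
      ultimately show ?thesis by (simp only:)
    qed
    show "((\<lambda>y::real. - (exp (- y) * (1 / (1 + y)^4))) \<longlongrightarrow> 0) at_top" by real_asymp
    show "0 \<le> ?f y" if "x \<le> y" for y using that assms by simp
  qed simp
  finally show ?thesis by simp
qed

lemma emeasure_exp_pareto_greaterThan:
  assumes "x \<ge> 0"
  shows "emeasure exp_pareto {x<..} = ennreal (exp (- x) / (1 + x)^4)"
proof -
  have "emeasure exp_pareto {x<..} = emeasure exp_pareto {x..}"
    unfolding exp_pareto_def
    using AE_lborel_singleton[of x]
    by (subst (1 2) emeasure_density) (auto intro!: nn_integral_cong_AE simp: indicator_def)
  with emeasure_exp_pareto_atLeast[OF assms] show ?thesis by simp
qed

lemma emeasure_exp_pareto_negative: "emeasure exp_pareto {..<0} = 0"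
  unfolding exp_pareto_def
  by (subst emeasure_density) (auto intro!: nn_integral_zero' simp: indicator_def)

lemma real_distribution_exp_pareto: "real_distribution exp_pareto"
proof -
  have "emeasure exp_pareto ({..<0} \<union> {0..}) = emeasure exp_pareto {..<0} + emeasure exp_pareto {0..}"
    by (rule plus_emeasure[symmetric]) auto
  also have "{..<0} \<union> {0..} = (UNIV :: real set)" by auto
  finally have "emeasure exp_pareto UNIV = 1"
    by (simp add: emeasure_exp_pareto_negative emeasure_exp_pareto_atLeast)
  then have "prob_space exp_pareto" by (intro prob_spaceI) simp
  then show ?thesis by (simp add: real_distribution_def real_distribution_axioms_def)
qed

lemma tail_exp_pareto: "x \<ge> 0 \<Longrightarrow> tail exp_pareto x = exp (- x) / (1 + x)^4"
  by (simp add: tail_eq_measure real_distribution_exp_pareto measure_def emeasure_exp_pareto_greaterThan)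

lemma exp_pareto_nonneg_unbounded: "exp_pareto \<in> nonneg_unbounded_distributions"
proof -
  have "cdf exp_pareto x < 1" for x
  proof -
    have "0 < tail exp_pareto (max x 0)"
      by (simp add: tail_exp_pareto zero_less_power)
    also have "\<dots> \<le> tail exp_pareto x"
      by (intro tail_antimono real_distribution_exp_pareto) simp
    finally show ?thesis by (simp add: tail_def)
  qed
  then show ?thesis
    by (simp add: nonneg_unbounded_distributions_def real_distribution_exp_pareto measure_def
        emeasure_exp_pareto_negative)
qed

lemma exp_moment_exp_pareto: "exp_moment exp_pareto 1 = ennreal (4/3)"
proof -
  let ?f = "\<lambda>y::real. 1 / (1 + y)^4 + 4 / (1 + y)^5"
  have "exp_moment exp_pareto 1 = (\<integral>\<^sup>+y. ennreal (?f y) * indicator {0..} y \<partial>lborel)"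
    unfolding exp_moment_def exp_pareto_def
    by (subst nn_integral_density)
      (auto intro!: nn_integral_cong simp: indicator_def exp_minus field_simps simp flip: ennreal_mult)
  \<comment> \<open>The factor \<open>exp y\<close> cancels the exponential in the density; the
    rational remainder integrates to 1/3 + 1.\<close>
  also have "\<dots> = ennreal (0 - (- (1/3) * (1 / (1 + 0)^3) - 1 / (1 + 0)^4))"
  proof (rule nn_integral_FTC_atLeast)
    show "DERIV (\<lambda>y. - (1/3) * (1 / (1 + y)^3) - 1 / (1 + y)^4) y :> ?f y" if "0 \<le> y" for y
    proof -
      have "1 + y > 0" using that by simp
      have "DERIV (\<lambda>y. - (1/3) * (1 / (1 + y)^3) - 1 / (1 + y)^4) y :>
          - (1/3) * (- real 3 / (1 + y)^Suc 3) - (- real 4 / (1 + y)^Suc 4)"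
        by (intro DERIV_diff DERIV_cmult DERIV_inverse_power_shift \<open>1 + y > 0\<close>)
      moreover have "- (1/3) * (- real 3 / (1 + y)^Suc 3) - (- real 4 / (1 + y)^Suc 4) = ?f y"
        by (simp del: power_Suc)
      ultimately show ?thesis by (simp only:)
    qed
    show "((\<lambda>y::real. - (1/3) * (1 / (1 + y)^3) - 1 / (1 + y)^4) \<longlongrightarrow> 0) at_top" by real_asymp
    show "0 \<le> ?f y" if "0 \<le> y" for y using that by simp
  qed simp
  finally show ?thesis by simp
qed

text \<open>The exponential factors cancel exactly, and the quotient of the fourth powers tends to
  1.\<close>

lemma exp_pareto_class_L: "exp_pareto \<in> class_L 1"
proof -
  have "(\<lambda>x. tail exp_pareto (x + t)) \<sim>[at_top] (\<lambda>x. exp (- 1 * t) * tail exp_pareto x)" for t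
  proof -
    have "(\<lambda>x. exp (- (x + t)) / (1 + (x + t))^4) \<sim>[at_top] (\<lambda>x. exp (- 1 * t) * (exp (- x) / (1 + x)^4))"
    proof (rule asymp_equivI')
      have "((\<lambda>x. (1 + x)^4 / (1 + (x + t))^4) \<longlongrightarrow> 1) at_top" by real_asymp
      moreover have "\<forall>\<^sub>F x in at_top. (1 + x)^4 / (1 + (x + t))^4 =
          exp (- (x + t)) / (1 + (x + t))^4 / (exp (- 1 * t) * (exp (- x) / (1 + x)^4))"
        using eventually_gt_at_top[of 0] eventually_gt_at_top[of "-t"]
        by eventually_elim (simp add: exp_diff exp_minus field_simps)
      ultimately show "((\<lambda>x. exp (- (x + t)) / (1 + (x + t))^4 / (exp (- 1 * t) * (exp (- x) / (1 + x)^4)))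
          \<longlongrightarrow> 1) at_top"
        by (rule Lim_transform_eventually)
    qed
    moreover have "\<forall>\<^sub>F x in at_top. exp (- (x + t)) / (1 + (x + t))^4 = tail exp_pareto (x + t)"
      using eventually_ge_at_top[of "-t"] by eventually_elim (simp add: tail_exp_pareto)
    moreover have "\<forall>\<^sub>F x in at_top. exp (- 1 * t) * (exp (- x) / (1 + x)^4) = exp (- 1 * t) * tail exp_pareto x"
      using eventually_ge_at_top[of 0] by eventually_elim (simp add: tail_exp_pareto)
    ultimately show ?thesis by (simp add: asymp_equiv_cong)
  qed
  then show ?thesis by (simp add: class_L_def exp_pareto_nonneg_unbounded)
qed

text \<open>Divide \<open>tail_convolution_split\<close> by the tail. Dominated convergence sends
  the integral to the exponential moment 4/3, and the squared term vanishes because its quotient is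
  \<open>(1 + x)^4 / (1 + x/2)^8\<close>.\<close>

lemma exp_pareto_class_S: "exp_pareto \<in> class_S 1"
proof -
  let ?F = exp_pareto
  interpret real_distribution ?F by (rule real_distribution_exp_pareto)
  note [measurable] = tail_borel_measurable[OF real_distribution_exp_pareto]
  let ?s = "\<lambda>x y. indicator {..x/2} y * tail ?F (x - y) / tail ?F x"
  have AE_nonneg: "AE y in ?F. 0 \<le> y"
    by (rule AE_I[of _ _ "{..<0}"]) (auto simp: emeasure_exp_pareto_negative)
  have nn_exp: "(\<integral>\<^sup>+y. ennreal (exp y) \<partial>?F) = ennreal (4/3)"
    unfolding exp_moment_exp_pareto[symmetric] exp_moment_def
    using AE_nonneg by (intro nn_integral_cong_AE) (auto simp: indicator_def)
  have int_exp: "integrable ?F exp"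
    by (rule integrableI_bounded) (auto simp: nn_exp)
  have integral_exp: "integral\<^sup>L ?F exp = 4/3"
    using nn_exp by (subst integral_eq_nn_integral) auto
  have ratio: "?s x y = exp y * ((1 + x) / (1 + (x - y)))^4" if "0 \<le> y" "2 * y \<le> x" for x y
    using that by (simp add: tail_exp_pareto exp_diff exp_minus field_simps power_divide)
  have "((\<lambda>x. integral\<^sup>L ?F (?s x)) \<longlongrightarrow> integral\<^sup>L ?F exp) at_top"
  \<comment> \<open>For \<open>0 \<le> y\<close> and \<open>2 * y \<le> x\<close> the quotient
    \<open>(1 + x) / (1 + (x - y))\<close> is at most 2, so its fourth power is at most 16.\<close>
  proof (rule integral_dominated_convergence_at_top[where w = "\<lambda>y. 16 * exp y"])
    show "integrable ?F (\<lambda>y. 16 * exp y)" using int_exp by simp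
    show "AE y in ?F. ((\<lambda>x. ?s x y) \<longlongrightarrow> exp y) at_top"
      using AE_nonneg
    proof eventually_elim
      case (elim y)
      have "((\<lambda>x. exp y * ((1 + x) / (1 + (x - y)))^4) \<longlongrightarrow> exp y) at_top" by real_asymp
      moreover have "\<forall>\<^sub>F x in at_top. exp y * ((1 + x) / (1 + (x - y)))^4 = ?s x y"
        using eventually_ge_at_top[of "2 * y"] by eventually_elim (use elim ratio in auto)
      ultimately show ?case by (rule Lim_transform_eventually)
    qed
    show "\<forall>\<^sub>F x in at_top. AE y in ?F. norm (?s x y) \<le> 16 * exp y"
      using eventually_ge_at_top[of 0]
    proof eventually_elim
      case (elim x)
      show ?case using AE_nonneg
      proof eventually_elim
        fix y :: real assume "0 \<le> y"
        show "norm (?s x y) \<le> 16 * exp y"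
        proof (cases "2 * y \<le> x")
          case True
          have "((1 + x) / (1 + (x - y)))^4 \<le> 2^4"
            using True \<open>0 \<le> y\<close> \<open>0 \<le> x\<close> by (intro power_mono) (auto simp: divide_le_eq)
          moreover have "0 \<le> ((1 + x) / (1 + (x - y)))^4" by simp
          ultimately show ?thesis
            unfolding ratio[OF \<open>0 \<le> y\<close> True] by (simp add: abs_mult)
        qed (simp add: indicator_def)
      qed
    qed
  qed measurable
  moreover have "((\<lambda>x. (tail ?F (x/2))\<^sup>2 / tail ?F x) \<longlongrightarrow> 0) at_top"
  proof -
    have "((\<lambda>x::real. (1 + x)^4 / (1 + x/2)^8) \<longlongrightarrow> 0) at_top" by real_asymp
    moreover have "\<forall>\<^sub>F x in at_top. (1 + x)^4 / (1 + x/2)^8 = (tail ?F (x/2))\<^sup>2 / tail ?F x"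
      using eventually_ge_at_top[of 0]
    proof eventually_elim
      case (elim x)
      have "(exp (- (x/2)))\<^sup>2 = exp (- x)" by (simp flip: exp_double)
      moreover have "((1 + x/2)^4)\<^sup>2 = (1 + x/2)^8" by (simp flip: power_mult)
      ultimately show ?case using elim by (simp add: tail_exp_pareto power_divide)
    qed
    ultimately show ?thesis by (rule Lim_transform_eventually)
  qed
  ultimately have "((\<lambda>x. 2 * integral\<^sup>L ?F (?s x) + (tail ?F (x/2))\<^sup>2 / tail ?F x)
      \<longlongrightarrow> 2 * (4/3) + 0) at_top"
    unfolding integral_exp by (intro tendsto_intros)
  moreover have "2 * integral\<^sup>L ?F (?s x) + (tail ?F (x/2))\<^sup>2 / tail ?F x
      = tail (convolution ?F ?F) x / tail ?F x" for x
    by (simp add: tail_convolution_split[OF real_distribution_exp_pareto] add_divide_distrib)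
  ultimately have "tail (convolution ?F ?F) \<sim>[at_top] (\<lambda>x. (2 * (4/3)) * tail ?F x)"
    by (intro asymp_equivI'_const) simp_all
  then show ?thesis
    by (simp add: class_S_def exp_pareto_class_L exp_moment_exp_pareto)
qed


subsection \<open>The two examples\<close>

lemma no_delay: "delay (\<lambda>_. 0)"
  by unfold_locales (auto simp: one_le_power)

text \<open>Both tails come from the same function, evaluated at \<open>x\<close> and at the next
  integer \<open>m \<le> x + 1\<close>. Rounding up costs at most a factor \<open>exp 1\<close> in
  the exponential and \<open>2^4\<close> in the polynomial.\<close>

lemma weakly_tail_equivalent_exp_pareto:
  assumes "lattice_tail p (delayed_decay (\<lambda>_. 0)) 64"
  shows "weakly_tail_equivalent (lattice_law p) exp_pareto"
proof -
  interpret lattice_tail p "delayed_decay (\<lambda>_. 0)" 64 by fact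
  let ?g = "\<lambda>x::real. exp (- x) / (1 + x)^4"
  have pos: "0 < ?g x" if "0 \<le> x" for x
    using that by (simp add: zero_less_power)
  have *: "tail (lattice_law p) x \<le> tail exp_pareto x \<and> tail exp_pareto x \<le> 16 * exp 1 * tail (lattice_law p) x"
    and nn: "0 < tail (lattice_law p) x" "0 < tail exp_pareto x" if "0 \<le> x" for x
  proof -
    define m where "m = nat \<lfloor>x\<rfloor> + 1"
    have m: "x \<le> real m" "real m \<le> x + 1" using that by (auto simp: m_def) linarith
    have tF: "tail (lattice_law p) x = ?g (real m)"
      using that by (simp add: tail_lattice_law prob_atLeast m_def delayed_decay_def)
    have tG: "tail exp_pareto x = ?g x" using that by (simp add: tail_exp_pareto)
    have "?g (real m) \<le> ?g x"
      using m that by (intro frac_le power_mono) (auto simp: zero_less_power)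
    moreover have "?g x \<le> 16 * exp 1 * ?g (real m)"
    proof -
      have "(1 + real m)^4 \<le> (2 * (1 + x))^4" using m that by (intro power_mono) auto
      also have "\<dots> = 16 * (1 + x)^4" unfolding power_mult_distrib by simp
      finally have "(1 + real m)^4 / 16 \<le> (1 + x)^4" by simp
      then have "?g x \<le> exp (1 - real m) / ((1 + real m)^4 / 16)"
        using m that by (intro frac_le) (auto simp: zero_less_power)
      also have "\<dots> = 16 * exp 1 * ?g (real m)" by (simp add: exp_diff exp_minus field_simps)
      finally show ?thesis .
    qed
    ultimately show "tail (lattice_law p) x \<le> tail exp_pareto x \<and> tail exp_pareto x \<le> 16 * exp 1 * tail (lattice_law p) x"
      by (simp add: tF tG)
    show "0 < tail (lattice_law p) x" "0 < tail exp_pareto x"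
      unfolding tF tG using pos that by auto
  qed
  have "tail (lattice_law p) \<in> O(tail exp_pareto)"
    by (rule bigoI[of _ 1], rule eventually_mono[OF eventually_ge_at_top[of 0]])
      (use * nn in \<open>fastforce simp: less_imp_le\<close>)
  moreover have "tail exp_pareto \<in> O(tail (lattice_law p))"
    by (rule bigoI[of _ "16 * exp 1"], rule eventually_mono[OF eventually_ge_at_top[of 0]])
      (use * nn in \<open>fastforce simp: less_imp_le\<close>)
  ultimately show ?thesis by (simp add: weakly_tail_equivalent_def)
qed

text \<open>Weak equivalence transfers the decay of \<open>F1\<close> to \<open>F\<close> with a
  constant \<open>B\<close> chosen before \<open>t\<close>; only the threshold in \<open>x\<close>
  depends on \<open>t\<close>. This uniformity is what makes large \<open>t\<close> useful
  later.\<close>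

lemma weakly_tail_equivalent_class_L_decay:
  assumes wte: "weakly_tail_equivalent F F1" and L: "F1 \<in> class_L \<gamma>"
    and F: "F \<in> nonneg_unbounded_distributions"
  obtains B where "\<And>t. t > 0 \<Longrightarrow> \<forall>\<^sub>F x in at_top. tail F (x + t) \<le> B * exp (- \<gamma> * t) * tail F x"
proof -
  have F1: "F1 \<in> nonneg_unbounded_distributions" using L by (simp add: class_L_def)
  note pos = tail_nonneg_unbounded_pos[OF F] tail_nonneg_unbounded_pos[OF F1]
  have O: "tail F \<in> O(tail F1)" "tail F1 \<in> O(tail F)"
    using wte by (auto simp: weakly_tail_equivalent_def)
  obtain C1 where C1: "C1 > 0" "\<forall>\<^sub>F x in at_top. norm (tail F x) \<le> C1 * norm (tail F1 x)"
    using O(1) by (rule landau_o.bigE)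
  obtain C2 where C2: "C2 > 0" "\<forall>\<^sub>F x in at_top. norm (tail F1 x) \<le> C2 * norm (tail F x)"
    using O(2) by (rule landau_o.bigE)
  show thesis
  \<comment> \<open>\<open>C1\<close> and \<open>C2\<close> come from the two comparisons of tails,
    and the 2 from weakening the asymptotic equality for \<open>F1\<close> to an eventual upper
    bound.\<close>
  proof (rule that[of "C1 * 2 * C2"])
    fix t :: real assume "t > 0"
    have "(\<lambda>x. tail F1 (x + t)) \<sim>[at_top] (\<lambda>x. exp (- \<gamma> * t) * tail F1 x)"
      using L \<open>t > 0\<close> by (simp add: class_L_def)
    from asymp_equiv_imp_eventually_le[OF this, of 2]
    have ev: "\<forall>\<^sub>F x in at_top. tail F1 (x + t) \<le> 2 * (exp (- \<gamma> * t) * tail F1 x)"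
      using pos by (simp add: abs_mult less_imp_le)
    have "filterlim (\<lambda>x. x + t) at_top at_top" by real_asymp
    with C1(2) have "\<forall>\<^sub>F x in at_top. norm (tail F (x + t)) \<le> C1 * norm (tail F1 (x + t))"
      by (rule eventually_compose_filterlim)
    with ev C2(2) show "\<forall>\<^sub>F x in at_top. tail F (x + t) \<le> C1 * 2 * C2 * exp (- \<gamma> * t) * tail F x"
    proof eventually_elim
      case (elim x)
      have "tail F (x + t) \<le> C1 * tail F1 (x + t)"
        using elim pos by (simp add: less_imp_le)
      also have "\<dots> \<le> C1 * (2 * (exp (- \<gamma> * t) * tail F1 x))"
        using elim C1 by (intro mult_left_mono) auto
      also have "\<dots> \<le> C1 * (2 * (exp (- \<gamma> * t) * (C2 * tail F x)))"
        using elim C1 pos by (intro mult_left_mono) (auto simp: less_imp_le)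
      finally show ?case by (simp add: mult_ac)
    qed
  qed
qed

text \<open>At the start of a run of length at least \<open>t\<close>, the delay grows as fast as
  the argument, so the exponential factors at \<open>m\<close> and \<open>m + t\<close> agree. Only
  the polynomial quotient remains, at most 16 when \<open>t \<le> m\<close>.\<close>

lemma plateau_law_frequently:
  assumes "lattice_tail p (delayed_decay plateau_delay) 64"
  shows "\<exists>\<^sub>F x in at_top. tail (lattice_law p) x \<le> 16 * tail (lattice_law p) (x + real t)"
  unfolding frequently_def
proof
  interpret lattice_tail p "delayed_decay plateau_delay" 64 by fact
  assume "\<forall>\<^sub>F x in at_top. \<not> tail (lattice_law p) x \<le> 16 * tail (lattice_law p) (x + real t)"
  then obtain N where N: "\<not> tail (lattice_law p) x \<le> 16 * tail (lattice_law p) (x + real t)"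
    if "x \<ge> N" for x
    unfolding eventually_at_top_linorder by blast
  \<comment> \<open>Since \<open>k < 2^k\<close>, this choice makes the run longer than
    \<open>t\<close> and starts it beyond \<open>N\<close>.\<close>
  define k where "k = max t (nat \<lceil>N\<rceil>) + 1"
  define m where "m = 2^2^Suc k + (2::nat)^k"
  have "k < 2^k" by (rule less_exp)
  then have k: "t + 1 \<le> 2^k" "nat \<lceil>N\<rceil> + 1 \<le> 2^k" by (auto simp: k_def)
  then have mt: "t \<le> m" "nat \<lceil>N\<rceil> + 1 \<le> m" by (auto simp: m_def)
  \<comment> \<open>The lattice tail at \<open>m - 1\<close> is \<open>T m\<close>, the tail being
    strict.\<close>
  define x where "x = real (m - 1)"
  have "N \<le> x"
  proof -
    have "N \<le> real (nat \<lceil>N\<rceil>)" by (rule real_nat_ceiling_ge)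
    also have "\<dots> \<le> x" using mt(2) unfolding x_def by (intro of_nat_mono) linarith
    finally show ?thesis .
  qed
  have m1: "nat \<lfloor>x\<rfloor> + 1 = m"
    using mt(2) unfolding x_def floor_of_nat nat_int by linarith
  have m2: "nat \<lfloor>x + real t\<rfloor> + 1 = m + t"
  proof -
    have "x + real t = real (m - 1 + t)" unfolding x_def of_nat_add ..
    then have "nat \<lfloor>x + real t\<rfloor> = m - 1 + t" by (simp only: floor_of_nat nat_int)
    then show ?thesis using mt(2) by linarith
  qed
  have D: "plateau_delay (m + t) = plateau_delay m + real t"
    using k(1) by (intro plateau_delay_runs[OF _ m_def]) simp
  have "(1 + real (m + t))^4 \<le> (2 * (1 + real m))^4"
    using mt by (intro power_mono) auto
  also have "\<dots> = 16 * (1 + real m)^4" unfolding power_mult_distrib by simp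
  finally have "(1 + real (m + t))^4 / 16 \<le> (1 + real m)^4" by simp
  then have "exp (plateau_delay m - real m) / (1 + real m)^4
      \<le> exp (plateau_delay m - real m) / ((1 + real (m + t))^4 / 16)"
    by (intro frac_le) (auto simp: zero_less_power)
  then have "delayed_decay plateau_delay m \<le> 16 * delayed_decay plateau_delay (m + t)"
    by (simp add: delayed_decay_def D mult.commute)
  moreover have "0 \<le> x" "0 \<le> x + real t" by (simp_all add: x_def)
  ultimately have "tail (lattice_law p) x \<le> 16 * tail (lattice_law p) (x + real t)"
    by (simp only: tail_lattice_law m1 m2 prob_atLeast)
  with N \<open>N \<le> x\<close> show False by blast
qed

text \<open>Weak equivalence would force decay by \<open>B * exp (- \<gamma> * t)\<close> over every
  sufficiently late window of length \<open>t\<close>, but on the plateaus the loss is at most a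
  factor 16. Comparing the two gives a lower bound 1 for a sequence in \<open>t\<close> that tends
  to 0.\<close>

lemma plateau_law_not_weakly_tail_equivalent:
  assumes p: "lattice_tail p (delayed_decay plateau_delay) 64" and "\<gamma> > 0" "F1 \<in> class_L \<gamma>"
  shows "\<not> weakly_tail_equivalent (lattice_law p) F1"
proof
  interpret lattice_tail p "delayed_decay plateau_delay" 64 by (rule p)
  let ?F = "lattice_law p"
  have F: "?F \<in> nonneg_unbounded_distributions"
    using lattice_law_class_J by (simp add: class_J_def)
  note pos = tail_nonneg_unbounded_pos[OF F]
  assume "weakly_tail_equivalent ?F F1"
  from weakly_tail_equivalent_class_L_decay[OF this assms(3) F]
  obtain B where B: "t > 0 \<Longrightarrow> \<forall>\<^sub>F x in at_top. tail ?F (x + t) \<le> B * exp (- \<gamma> * t) * tail ?F x" for t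
    by blast
  have ge: "1 \<le> 16 * B * exp (- \<gamma> * real t)" if "t > 0" for t
  proof -
    have "\<forall>\<^sub>F x in at_top. tail ?F (x + real t) \<le> B * exp (- \<gamma> * real t) * tail ?F x"
      using that by (intro B) simp
    from frequently_ex[OF frequently_eventually_conj[OF plateau_law_frequently[OF p] this]]
    obtain x where "tail ?F x \<le> 16 * tail ?F (x + real t)"
        "tail ?F (x + real t) \<le> B * exp (- \<gamma> * real t) * tail ?F x"
      by blast
    then have "1 * tail ?F x \<le> 16 * B * exp (- \<gamma> * real t) * tail ?F x" by simp
    then show ?thesis using pos[of x] by (simp only: mult_le_cancel_right_pos)
  qed
  have "(\<lambda>t. 16 * B * exp (- \<gamma> * real t)) \<longlonglongrightarrow> 0"
    using \<open>\<gamma> > 0\<close> by real_asymp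
  then have "(1 :: real) \<le> 0"
    by (rule tendsto_lowerbound) (use ge in \<open>auto intro: eventually_mono[OF eventually_gt_at_top[of 0]]\<close>)
  then show False by simp
qed

theorem theorem1p1:
  shows "(class_J \<inter> class_Kc = class_JKc1 \<union> class_JKc2 \<and>
          class_JKc1 - (\<Union>\<beta>\<in>{0<..}. class_S \<beta>) \<noteq> {} \<and>
          class_JKc2 - (\<Union>\<beta>\<in>{0<..}. class_S \<beta>) \<noteq> {}) \<and>
         (class_J = class_J1 \<union> class_J2 \<and>
          class_J1 - (\<Union>\<beta>\<in>{0..}. class_S \<beta>) \<noteq> {} \<and>
          class_J2 - (\<Union>\<beta>\<in>{0..}. class_S \<beta>) \<noteq> {})"
proof -
  interpret A: delay "\<lambda>_. 0" by (rule no_delay)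
  interpret B: delay plateau_delay by (rule plateau_delay)
  obtain p where p: "lattice_tail p A.T 64" by (rule A.exists_pmf)
  obtain q where q: "lattice_tail q B.T 64" by (rule B.exists_pmf)
  interpret p: lattice_tail p A.T 64 by (rule p)
  interpret q: lattice_tail q B.T 64 by (rule q)
  have p1: "lattice_law p \<in> class_JKc1"
    unfolding class_JKc1_def
    using p.lattice_law_class_J A.lattice_law_light_tailed[OF p] exp_pareto_class_S
      weakly_tail_equivalent_exp_pareto[OF p]
    \<comment> \<open>The index is 1 because \<open>exp_pareto\<close> belongs to
      \<open>class_S 1\<close>.\<close>
    by (auto intro!: exI[of _ "1::real"])
  have "F1 \<in> class_L \<gamma>" if "F1 \<in> class_S \<gamma>" "\<gamma> > 0" for F1 \<gamma>
    using that by (simp add: class_S_def)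
  then have q2: "lattice_law q \<in> class_JKc2"
    unfolding class_JKc2_def class_JKc1_def
    using q.lattice_law_class_J B.lattice_law_light_tailed[OF q]
      plateau_law_not_weakly_tail_equivalent[OF q]
    by blast
  have notin: "lattice_law p \<notin> (\<Union>\<beta>\<in>{0..}. class_S \<beta>)" "lattice_law q \<notin> (\<Union>\<beta>\<in>{0..}. class_S \<beta>)"
    using A.lattice_law_not_class_S[OF p] B.lattice_law_not_class_S[OF q] by auto
  have "(\<Union>\<beta>\<in>{0<..}. class_S \<beta>) \<subseteq> (\<Union>\<beta>\<in>{0..}. class_S \<beta>)"
    by (intro UN_mono) auto
  then have notin_pos: "lattice_law p \<notin> (\<Union>\<beta>\<in>{0<..}. class_S \<beta>)" "lattice_law q \<notin> (\<Union>\<beta>\<in>{0<..}. class_S \<beta>)"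
    using notin by (metis subsetD)+
  have J: "lattice_law p \<in> class_J1" "lattice_law q \<in> class_J2"
    using p1 q2 by (auto simp: class_J1_def class_J2_def)
  have "class_J \<inter> class_Kc = class_JKc1 \<union> class_JKc2"
    by (auto simp: class_JKc2_def class_JKc1_def)
  moreover have "class_J = class_J1 \<union> class_J2"
    by (auto simp: class_J1_def class_J2_def class_JKc2_def class_JKc1_def class_JK1_def class_JK2_def
        class_Kc_def class_J_def)
  moreover have "A - B \<noteq> {}" if "x \<in> A" "x \<notin> B" for A B and x :: "real measure"
    using that by blast
  note this[OF p1 notin_pos(1)] this[OF q2 notin_pos(2)] this[OF J(1) notin(1)] this[OF J(2) notin(2)]
  ultimately show ?thesis by (intro conjI)
qed

end
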